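(* For each finite set $S$ of rational primes there are constants $k_S$ and $C_S$ with $$\mathsf M_S(N)=k_S\log N+C_S+O(N^{-1})\qquad (N\to\infty).$$ The set of values $k_S$ obtained as $S$ varies among the finite subsets of the set $\mathbb P$ of rational primes is dense in $[0,1]$.
   Context: $\mathbb P$ is the set of rational primes and $|\cdot|_p$ is the $p$-adic absolute value on $\mathbb Q$ with $|p|_p=p^{-1}$. For $S\subseteq\mathbb P$ let $R_S=\{r\in\mathbb Q: |r|_p\le 1\text{ for all }p\in\mathbb P\setminus S\}$, and let $T_S$ be the continuous endomorphism of the compact dual group $\widehat{R_S}$ dual to $r\mapsto 2r$ on the discrete group $R_S$. A closed orbit $\tau$ of length $|\tau|=n$ is a set $\{x,T_S(x),\dots,T_S^n(x)=x\}$ of cardinality $n$. Define $\mathsf M_S(N)=\sum_{|\tau|\le N}e^{-h|\tau|}$, the sum over closed orbits of $T_S$ of length at most $N$, where $h=h(T_S)$ is the topological entropy. It is known that $h(T_S)=\log 2$ and that the number of points with $T_S^nx=x$ is $(2^n-1)\prod_{p\in S}|2^n-1|_p$, so that, with $|x|_S=\prod_{p\in S}|x|_p$ and $\mu$ the Möbius function, $$\mathsf M_S(N)=\sum_{n\le N}\frac1{n2^n}\sum_{d\mid n}\mu(n/d)\,(2^d-1)\,|2^d-1|_S .$$ The existence of $k_S$ and $C_S$ for finite $S$ is a previously known result; the constant $k_S$ is uniquely determined by $S$. *)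

theory Defs
  imports
    "HOL-Analysis.Analysis"
    "HOL-Computational_Algebra.Primes"
    "HOL-Library.Landau_Symbols"
begin

definition padic_abs :: "nat \<Rightarrow> rat \<Rightarrow> real" where
  "padic_abs p r =
     (if r = 0 then 0
      else real p powi (int (multiplicity (int p) (snd (quotient_of r)))
                        - int (multiplicity (int p) (fst (quotient_of r)))))"

definition R_ring :: "nat set \<Rightarrow> rat set" where
  "R_ring S = {r. \<forall>p. prime p \<and> p \<notin> S \<longrightarrow> padic_abs p r \<le> 1}"

text \<open>
  Characters are functions on the whole type \<^typ>\<open>rat\<close>; they are made extensional (equal to
  \<^term>\<open>undefined\<close> outside the group), so that equality of characters is equality on the group.
\<close>
definition characters :: "rat set \<Rightarrow> (rat \<Rightarrow> complex) set" where
  "characters G =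
     {\<phi> \<in> G \<rightarrow>\<^sub>E sphere 0 1. \<forall>r\<in>G. \<forall>s\<in>G. \<phi> (r + s) = \<phi> r * \<phi> s}"

text \<open>
  The compact-open topology on the dual of a discrete group is the topology of pointwise
  convergence, i.e. the subspace topology from the product of circles.
\<close>
definition dual_topology :: "rat set \<Rightarrow> (rat \<Rightarrow> complex) topology" where
  "dual_topology G =
     subtopology (product_topology (\<lambda>_. top_of_set (sphere 0 1)) G) (characters G)"

definition T_map :: "nat set \<Rightarrow> (rat \<Rightarrow> complex) \<Rightarrow> (rat \<Rightarrow> complex)" where
  "T_map S \<phi> = (\<lambda>r\<in>R_ring S. \<phi> (2 * r))"

text \<open>
  Topological entropy after Adler, Konheim and McAndrew: \<open>join_cover X T \<U> n\<close> is
  the common refinement of the preimages of \<open>\<U>\<close> under the first \<open>n\<close> iterates of \<open>T\<close>.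
\<close>
definition open_cover :: "'a topology \<Rightarrow> 'a set set \<Rightarrow> bool" where
  "open_cover X \<U> \<longleftrightarrow> (\<forall>U\<in>\<U>. openin X U) \<and> \<Union>\<U> = topspace X"

definition cover_number :: "'a topology \<Rightarrow> 'a set set \<Rightarrow> nat" where
  "cover_number X \<U> =
     (LEAST k. \<exists>\<V>\<subseteq>\<U>. finite \<V> \<and> card \<V> = k \<and> \<Union>\<V> = topspace X)"

definition join_cover :: "'a topology \<Rightarrow> ('a \<Rightarrow> 'a) \<Rightarrow> 'a set set \<Rightarrow> nat \<Rightarrow> 'a set set" where
  "join_cover X T \<U> n =
     {{x \<in> topspace X. \<forall>i<n. (T ^^ i) x \<in> f i} | f. \<forall>i<n. f i \<in> \<U>}"

text \<open>
  For continuous \<open>T\<close> on a compact space, \<open>limsup\<close> is a limit, by subadditivity.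
\<close>
definition cover_entropy :: "'a topology \<Rightarrow> ('a \<Rightarrow> 'a) \<Rightarrow> 'a set set \<Rightarrow> ereal" where
  "cover_entropy X T \<U> =
     limsup (\<lambda>n. ereal (ln (real (cover_number X (join_cover X T \<U> n))) / real n))"

definition topological_entropy :: "'a topology \<Rightarrow> ('a \<Rightarrow> 'a) \<Rightarrow> ereal" where
  "topological_entropy X T = (SUP \<U>\<in>{\<U>. open_cover X \<U>}. cover_entropy X T \<U>)"

text \<open>
  The cardinality condition excludes \<open>n = 0\<close> and forces \<open>n\<close> to be the least period.
\<close>
definition closed_orbits :: "'a set \<Rightarrow> ('a \<Rightarrow> 'a) \<Rightarrow> nat \<Rightarrow> 'a set set" where
  "closed_orbits X T n =
     {\<tau>. \<exists>x\<in>X. \<tau> = (\<lambda>i. (T ^^ i) x) ` {0..n} \<and> (T ^^ n) x = x \<and> card \<tau> = n}"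

text \<open>
  The entropy is finite, so \<^const>\<open>real_of_ereal\<close> (which sends infinity to 0) loses nothing.
  The index set of the sum is finite, as the map has finitely many points of each period.
\<close>
definition M_sum :: "nat set \<Rightarrow> nat \<Rightarrow> real" where
  "M_sum S N =
     (let X = dual_topology (R_ring S);
          h = real_of_ereal (topological_entropy X (T_map S))
      in \<Sum>\<tau>\<in>(\<Union>n\<in>{..N}. closed_orbits (topspace X) (T_map S) n). exp (- h * real (card \<tau>)))"

definition mertens_asymp :: "nat set \<Rightarrow> real \<Rightarrow> real \<Rightarrow> bool" where
  "mertens_asymp S k C \<longleftrightarrow>
     (\<lambda>N. M_sum S N - (k * ln (real N) + C)) \<in> O(\<lambda>N. 1 / real N)"

definition leading_constants :: "real set" where
  "leading_constants =
     {k. \<exists>S C. finite S \<and> S \<subseteq> {p. prime p} \<and> mertens_asymp S k C}"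

end

theory Submission
  imports Defs "HOL-Number_Theory.Pocklington"
begin

text \<open>
  The entropy is \<open>ln 2\<close> because an open cover of the dual group only sees, uniformly, a single
  coordinate \<open>\<phi>(1/t)\<close>, on which the map acts by doubling the angle. The points of period \<open>n\<close>
  correspond to the \<open>b\<close>-th roots of unity, where \<open>b\<close> is the part of \<open>2\<^sup>n - 1\<close> prime to \<open>S\<close>; hence
  \<open>M_S(N)\<close> differs from \<open>\<Sum>\<^bsub>n\<le>N\<^esub> |2\<^sup>n - 1|\<^sub>S / n\<close> by a constant and a geometrically small error.
  Expanding \<open>|2\<^sup>n - 1|\<^sub>p\<close> as an absolutely convergent combination of the indicators of
  \<open>ord(p\<^sup>j, 2) | n\<close> gives the asymptotics. So \<open>k_S\<close> is the logarithmic mean of \<open>|2\<^sup>n - 1|\<^sub>S\<close>.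

  For density, choose for each prime \<open>q \<ge> Q\<close> a prime \<open>p\<close> modulo which 2 has order \<open>q\<close> and adjoin these
  \<open>p\<close> one after the other, starting from \<open>k = 1\<close> for the empty set. Each step lowers \<open>k\<close> by at
  most \<open>1/q \<le> 1/Q\<close>, and \<open>k\<close> tends to 0, being at most \<open>\<Prod>\<^sub>q (1 - 1/(2q))\<close>, which diverges to 0
  since \<open>\<Sum>\<^sub>q 1/q\<close> diverges.
\<close>

subsection \<open>The ring of S-integers\<close>

text \<open>\<open>R_S\<close> is the directed union of the cyclic groups generated by
  \<open>1/t\<close>, where all primes of \<open>t\<close> lie in \<open>S\<close>; this is why
  finitely many coordinates of a character reduce to a single one. The count of periodic points
  rests on \<open>R_S / b R_S\<close> being cyclic of order \<open>b\<close>.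

  The obstacle to a convenient formula for \<open>k_S\<close> is that the orders of 2 modulo powers
  of different primes need not be coprime, so the expansions for different \<open>p\<close> do not
  multiply independently. Hence the asymptotics are obtained by induction over \<open>S\<close>, and
  density uses \<open>k_S\<close> only through comparisons of logarithmic means.

  Choosing \<open>p\<close> with prime order \<open>q\<close> keeps these comparisons simple. The
  new factor differs from 1 only at multiples of \<open>q\<close>, whose logarithmic density is
  \<open>1/q\<close>, and there it is at most \<open>1/2\<close>; since divisibility by distinct
  primes is independent on average, the bound \<open>1 - 1/(2q)\<close> is multiplicative. Starting
  at \<open>Q\<close> makes each step shorter than the tolerance, so the values cannot jump over a
  given interval; the finitely many primes below \<open>Q\<close> do not affect the
  divergence.\<close>

definition S_number :: "nat set \<Rightarrow> nat \<Rightarrow> bool" where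
  "S_number S t \<longleftrightarrow> t > 0 \<and> (\<forall>p. prime p \<and> p dvd t \<longrightarrow> p \<in> S)"

lemma S_number_1 [simp]: "S_number S 1" "S_number S (Suc 0)"
  by (auto simp: S_number_def)

lemma S_number_pos: "S_number S t \<Longrightarrow> t > 0"
  by (simp add: S_number_def)

lemma S_number_mult: "S_number S s \<Longrightarrow> S_number S t \<Longrightarrow> S_number S (s * t)"
  by (auto simp: S_number_def prime_dvd_mult_iff)

lemma S_number_dvd: "S_number S t \<Longrightarrow> s dvd t \<Longrightarrow> S_number S s"
  by (auto simp: S_number_def intro: dvd_trans dest: dvd_pos_nat)

lemma S_number_prod:
  "finite A \<Longrightarrow> (\<And>x. x \<in> A \<Longrightarrow> S_number S (f x)) \<Longrightarrow> S_number S (prod f A)"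
  by (induction A rule: finite_induct) (auto intro: S_number_mult)

text \<open>In lowest terms \<open>p\<close> cannot divide numerator and denominator at once, so
  comparing the two multiplicities amounts to testing the denominator alone.\<close>

lemma padic_abs_le_1_iff:
  assumes "prime p"
  shows "padic_abs p r \<le> 1 \<longleftrightarrow> \<not> int p dvd snd (quotient_of r)"
proof (cases "r = 0")
  case True
  then show ?thesis using assms prime_gt_1_nat[OF assms] by (auto simp: padic_abs_def)
next
  case False
  obtain a b where ab: "quotient_of r = (a, b)" by fastforce
  have b: "b > 0" "coprime a b"
    using ab quotient_of_denom_pos quotient_of_coprime by blast+
  have a: "a \<noteq> 0" using False quotient_of_div[OF ab] by auto
  have p: "prime (int p)" "real p > 1" using assms prime_gt_1_nat[OF assms] by auto
  have power_int_le_iff_le: "real p powi i \<le> 1 \<longleftrightarrow> i \<le> 0" for i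
    using p(2) power_int_strict_increasing[of 0 i "real p"] power_int_increasing[of i 0 "real p"]
    by (cases "i \<le> 0") auto
  have iff: "padic_abs p r \<le> 1 \<longleftrightarrow> multiplicity (int p) b \<le> multiplicity (int p) a"
    using False ab power_int_le_iff_le by (auto simp: padic_abs_def)
  show ?thesis
  proof (cases "int p dvd b")
    case True
    then have "\<not> int p dvd a" using b(2) p(1) not_prime_unit coprime_common_divisor by blast
    moreover have "multiplicity (int p) b > 0" using True p(1) b(1)
      by (simp add: prime_multiplicity_gt_zero_iff)
    ultimately show ?thesis using iff True ab by (auto simp: not_dvd_imp_multiplicity_0)
  next
    case False
    then show ?thesis using iff ab by (auto simp: not_dvd_imp_multiplicity_0)
  qed
qed

text \<open>The fraction on the right need not be reduced, which makes closure under the ring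
  operations immediate. Conversely the reduced denominator divides \<open>t\<close>, so its primes
  lie in \<open>S\<close> as well.\<close>

lemma in_R_ring_iff: "r \<in> R_ring S \<longleftrightarrow> (\<exists>j t. S_number S t \<and> r = of_int j / of_nat t)"
proof
  assume r: "r \<in> R_ring S"
  obtain a b where ab: "quotient_of r = (a, b)" by fastforce
  have b: "b > 0" using ab quotient_of_denom_pos by blast
  have "S_number S (nat b)"
    unfolding S_number_def
  proof (intro conjI allI impI)
    fix p assume p: "prime p \<and> p dvd nat b"
    then have "int p dvd b" using b by (metis int_dvd_int_iff int_nat_eq less_imp_le)
    then show "p \<in> S" using r p ab by (auto simp: R_ring_def padic_abs_le_1_iff)
  qed (use b in auto)
  moreover have "r = of_int a / of_nat (nat b)" using quotient_of_div[OF ab] b by simp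
  ultimately show "\<exists>j t. S_number S t \<and> r = of_int j / of_nat t" by blast
next
  assume "\<exists>j t. S_number S t \<and> r = of_int j / of_nat t"
  then obtain j t where t: "S_number S t" and r: "r = of_int j / of_nat t" by blast
  obtain a b where ab: "quotient_of r = (a, b)" by fastforce
  have b: "b > 0" "coprime a b" "r = of_int a / of_int b"
    using ab quotient_of_denom_pos quotient_of_coprime quotient_of_div by blast+
  have "(of_int a :: rat) * of_nat t = of_int j * of_int b"
    using b r S_number_pos[OF t] by (auto simp: field_simps)
  then have "a * int t = j * b" by (metis of_int_eq_iff of_int_mult of_int_of_nat_eq)
  then have "b dvd int t" using b(2) by (metis coprime_commute coprime_dvd_mult_right_iff dvd_triv_right)
  then have "p \<in> S" if "prime p" "int p dvd b" for p
    using t that dvd_trans[of "int p" b "int t"] by (auto simp: S_number_def)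
  then show "r \<in> R_ring S"
    using ab by (auto simp: R_ring_def padic_abs_le_1_iff)
qed

lemma R_ring_add:
  assumes "r \<in> R_ring S" "s \<in> R_ring S" shows "r + s \<in> R_ring S"
proof -
  obtain i t j u where "S_number S t" "r = of_int i / of_nat t"
    "S_number S u" "s = of_int j / of_nat u"
    using assms by (auto simp: in_R_ring_iff)
  then have "S_number S (t * u)" "r + s = of_int (i * int u + j * int t) / of_nat (t * u)"
    by (auto simp: S_number_mult field_simps dest!: S_number_pos)
  then show ?thesis unfolding in_R_ring_iff by blast
qed

lemma R_ring_mult:
  assumes "r \<in> R_ring S" "s \<in> R_ring S" shows "r * s \<in> R_ring S"
proof -
  obtain i t j u where "S_number S t" "r = of_int i / of_nat t"
    "S_number S u" "s = of_int j / of_nat u"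
    using assms by (auto simp: in_R_ring_iff)
  then have "S_number S (t * u)" "r * s = of_int (i * j) / of_nat (t * u)"
    by (auto simp: S_number_mult)
  then show ?thesis unfolding in_R_ring_iff by blast
qed

lemma R_ring_of_int [simp]: "of_int j \<in> R_ring S"
  unfolding in_R_ring_iff by (rule exI[of _ j], rule exI[of _ 1]) auto

lemma R_ring_of_nat [simp]: "of_nat j \<in> R_ring S"
  using R_ring_of_int[of "int j"] by simp

lemma R_ring_numerals [simp]: "0 \<in> R_ring S" "1 \<in> R_ring S" "numeral k \<in> R_ring S"
  using R_ring_of_int[of 0] R_ring_of_int[of 1] R_ring_of_int[of "numeral k"] by simp_all

lemma R_ring_inverse_S_number: "S_number S t \<Longrightarrow> 1 / of_nat t \<in> R_ring S"
  unfolding in_R_ring_iff by (metis of_int_1)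

lemma R_ring_uminus: "r \<in> R_ring S \<Longrightarrow> - r \<in> R_ring S"
  using R_ring_mult[of r S "of_int (-1)"] R_ring_of_int[of "-1"] by simp

lemma R_ring_diff: "r \<in> R_ring S \<Longrightarrow> s \<in> R_ring S \<Longrightarrow> r - s \<in> R_ring S"
  using R_ring_add[OF _ R_ring_uminus] by fastforce

lemma expand_fraction:
  assumes "t > 0"
  shows "(of_int i :: rat) / of_nat u = of_int (i * int t) / of_nat (t * u)"
proof -
  have "(of_nat t :: rat) \<noteq> 0" using assms by simp
  then have "(of_int i :: rat) / of_nat u = (of_nat t * of_int i) / (of_nat t * of_nat u)"
    by (rule mult_divide_mult_cancel_left[symmetric])
  then show ?thesis by (simp only: of_int_mult of_nat_mult of_int_of_nat_eq mult.commute)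
qed

text \<open>Directedness of the union of the groups generated by \<open>1/t\<close>. It lets a
  condition on finitely many coordinates of a character be replaced by one on the coordinate at
  \<open>1/t\<close>.\<close>

lemma common_denominator:
  assumes "finite F" "F \<subseteq> R_ring S"
  shows "\<exists>t. S_number S t \<and> (\<forall>r\<in>F. \<exists>j. r = of_int j / of_nat t)"
  using assms
proof (induction F rule: finite_induct)
  case empty
  show ?case using S_number_1(1)[of S] by blast
next
  case (insert x F)
  then obtain t where t: "S_number S t" "\<forall>r\<in>F. \<exists>j. r = of_int j / of_nat t" by auto
  obtain i u where u: "S_number S u" "x = of_int i / of_nat u"
    using insert.prems by (auto simp: in_R_ring_iff)
  show ?case
  proof (rule exI[of _ "t * u"], intro conjI ballI)
    show "S_number S (t * u)" by (rule S_number_mult[OF t(1) u(1)])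
    fix r assume "r \<in> insert x F"
    then consider "r = x" | "r \<in> F" by blast
    then show "\<exists>j. r = of_int j / of_nat (t * u)"
    proof cases
      case 1
      then show ?thesis unfolding u(2) using expand_fraction[OF S_number_pos[OF t(1)]] by blast
    next
      case 2
      then obtain j where "r = of_int j / of_nat t" using t by blast
      then show ?thesis
        using expand_fraction[OF S_number_pos[OF u(1)], of j t] by (metis mult.commute)
    qed
  qed
qed

subsection \<open>Characters\<close>

lemma characters_norm: "\<phi> \<in> characters G \<Longrightarrow> r \<in> G \<Longrightarrow> norm (\<phi> r) = 1"
  by (auto simp: characters_def PiE_def Pi_def)

lemma characters_add:
  "\<phi> \<in> characters G \<Longrightarrow> r \<in> G \<Longrightarrow> s \<in> G \<Longrightarrow> \<phi> (r + s) = \<phi> r * \<phi> s"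
  by (auto simp: characters_def)

lemma characters_eqI:
  assumes "\<phi> \<in> characters G" "\<psi> \<in> characters G" "\<And>r. r \<in> G \<Longrightarrow> \<phi> r = \<psi> r"
  shows "\<phi> = \<psi>"
  using assms by (auto simp: characters_def intro: PiE_ext)

lemma characters_0:
  assumes "\<phi> \<in> characters (R_ring S)"
  shows "\<phi> 0 = 1"
proof -
  have "\<phi> 0 = \<phi> 0 * \<phi> 0" using characters_add[OF assms, of 0 0] by simp
  moreover have "\<phi> 0 \<noteq> 0" using characters_norm[OF assms, of 0] by auto
  ultimately show ?thesis by simp
qed

lemma characters_of_nat_mult:
  assumes "\<phi> \<in> characters (R_ring S)" "r \<in> R_ring S"
  shows "\<phi> (of_nat n * r) = \<phi> r ^ n"
proof (induction n)
  case (Suc n)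
  then show ?case
    using characters_add[OF assms(1) assms(2), of "of_nat n * r"] assms(2)
    by (simp add: ring_distribs R_ring_mult)
qed (simp add: characters_0[OF assms(1)])

lemma characters_uminus:
  assumes "\<phi> \<in> characters (R_ring S)" "r \<in> R_ring S"
  shows "\<phi> (- r) = cnj (\<phi> r)"
proof -
  have "\<phi> r * \<phi> (- r) = 1"
    using characters_add[OF assms R_ring_uminus[OF assms(2)]] characters_0[OF assms(1)] by simp
  moreover have "\<phi> r * cnj (\<phi> r) = 1"
    using characters_norm[OF assms] by (simp add: complex_norm_square[symmetric])
  ultimately show ?thesis by (metis mult_cancel_left zero_neq_one mult_zero_left)
qed

lemma T_map_apply: "r \<in> R_ring S \<Longrightarrow> T_map S \<phi> r = \<phi> (2 * r)"
  by (simp add: T_map_def)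

lemma T_map_characters:
  assumes "\<phi> \<in> characters (R_ring S)"
  shows "T_map S \<phi> \<in> characters (R_ring S)"
  using assms
  by (auto simp: characters_def T_map_def R_ring_mult R_ring_add ring_distribs PiE_def Pi_def)

lemma T_map_funpow_characters:
  "\<phi> \<in> characters (R_ring S) \<Longrightarrow> (T_map S ^^ n) \<phi> \<in> characters (R_ring S)"
  by (induction n) (auto intro: T_map_characters)

lemma T_map_funpow_apply:
  assumes "r \<in> R_ring S"
  shows "(T_map S ^^ n) \<phi> r = \<phi> (2 ^ n * r)"
  using assms
proof (induction n arbitrary: r)
  case (Suc n)
  then show ?case using R_ring_mult[of 2 S r] by (simp add: T_map_apply mult.assoc mult.left_commute)
qed auto

lemma T_map_funpow_apply_power:
  assumes "\<phi> \<in> characters (R_ring S)" "r \<in> R_ring S"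
  shows "(T_map S ^^ n) \<phi> r = \<phi> r ^ (2 ^ n)"
  using characters_of_nat_mult[OF assms, of "2 ^ n"] T_map_funpow_apply[OF assms(2)] by simp

text \<open>The real line mapped into the dual group: each \<open>\<theta>\<close> gives a
  one-parameter family of values \<open>exp (2 pi i \<theta> r)\<close>. It supplies explicit points
  with a prescribed coordinate at \<open>1/t\<close> or at \<open>1\<close>.\<close>

definition exp_character :: "nat set \<Rightarrow> real \<Rightarrow> rat \<Rightarrow> complex" where
  "exp_character S \<theta> = (\<lambda>r\<in>R_ring S. cis (2 * pi * \<theta> * of_rat r))"

lemma exp_character_in: "exp_character S \<theta> \<in> characters (R_ring S)"
  by (auto simp: exp_character_def characters_def R_ring_add cis_mult of_rat_add ring_distribs)

lemma exp_character_apply: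
  "r \<in> R_ring S \<Longrightarrow> exp_character S \<theta> r = cis (2 * pi * \<theta> * of_rat r)"
  by (simp add: exp_character_def)

lemma topspace_dual_topology: "topspace (dual_topology G) = characters G"
  by (auto simp: dual_topology_def characters_def)

text \<open>By Tychonoff the product of circles is compact, and additivity is an intersection of
  equations between continuous maps, hence a closed condition.\<close>

lemma compact_dual_topology: "compact_space (dual_topology (R_ring S))"
proof -
  let ?C = "top_of_set (sphere 0 1 :: complex set)"
  let ?P = "product_topology (\<lambda>_::rat. ?C) (R_ring S)"
  have P: "compact_space ?P"
    by (auto simp: compact_space_product_topology compact_space_subtopology)
  have cont: "continuous_map ?P euclidean (\<lambda>\<phi>. \<phi> r)" if "r \<in> R_ring S" for r
    using continuous_map_product_projection[OF that, of "\<lambda>_. ?C"]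
    by (rule continuous_map_into_fulltopology)
  have mult: "continuous_map ?P euclidean (\<lambda>\<phi>. \<phi> r * \<phi> s)"
    if "r \<in> R_ring S" "s \<in> R_ring S" for r s
    using cont[OF that(1)] cont[OF that(2)] by (auto simp: continuous_map_atin intro: tendsto_mult)
  have "closedin ?P {\<phi> \<in> topspace ?P. \<phi> (r + s) = \<phi> r * \<phi> s}"
    if "r \<in> R_ring S" "s \<in> R_ring S" for r s
    by (rule closedin_continuous_maps_eq[of "euclidean :: complex topology"])
       (auto intro!: cont mult that R_ring_add simp: Hausdorff_space_euclidean)
  then have "closedin ?P (\<Inter>(r,s)\<in>R_ring S \<times> R_ring S. {\<phi> \<in> topspace ?P. \<phi> (r + s) = \<phi> r * \<phi> s})"
    by (intro closedin_INT) (auto intro: R_ring_numerals(1))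
  also have "(\<Inter>(r,s)\<in>R_ring S \<times> R_ring S. {\<phi> \<in> topspace ?P. \<phi> (r + s) = \<phi> r * \<phi> s})
    = characters (R_ring S)"
  proof (intro equalityI subsetI)
    fix \<phi> assume "\<phi> \<in> (\<Inter>(r,s)\<in>R_ring S \<times> R_ring S. {\<phi> \<in> topspace ?P. \<phi> (r + s) = \<phi> r * \<phi> s})"
    then have *: "\<phi> \<in> topspace ?P \<and> \<phi> (r + s) = \<phi> r * \<phi> s"
      if "r \<in> R_ring S" "s \<in> R_ring S" for r s
      using that by blast
    then have "\<phi> \<in> topspace ?P" using R_ring_numerals(1)[of S] by blast
    then show "\<phi> \<in> characters (R_ring S)" using * unfolding characters_def by simp
  qed (auto simp: characters_def)
  finally have "compactin ?P (characters (R_ring S))"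
    by (rule closedin_compact_space[OF P])
  then show ?thesis
    unfolding dual_topology_def by (rule compact_space_subtopology)
qed

section \<open>Neighbourhoods in the dual group seen through one coordinate\<close>

lemma uniform_lower_bound:
  assumes "finite A" "\<And>x. x \<in> A \<Longrightarrow> e x > (0::real)"
  shows "\<exists>d>0. \<forall>x\<in>A. d \<le> e x"
\<comment> \<open>Inserting \<open>1\<close> keeps the minimum meaningful when \<open>A\<close> is
  empty.\<close>
proof (intro exI[of _ "Min (insert 1 (e ` A))"] conjI ballI)
  show "Min (insert 1 (e ` A)) > 0" using assms by (subst Min_gr_iff) auto
  show "Min (insert 1 (e ` A)) \<le> e x" if "x \<in> A" for x using assms(1) that by (intro Min_le) auto
qed

text \<open>The map \<open>z \<mapsto> z ^ m\<close> is \<open>m\<close>-Lipschitz on the unit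
  circle; negative multiples reduce to positive ones because inversion on the circle is
  conjugation.\<close>

lemma norm_character_diff_le:
  assumes "\<phi> \<in> characters (R_ring S)" "\<psi> \<in> characters (R_ring S)" "S_number S t"
  shows "norm (\<psi> (of_int j / of_nat t) - \<phi> (of_int j / of_nat t))
           \<le> \<bar>of_int j\<bar> * norm (\<psi> (1 / of_nat t) - \<phi> (1 / of_nat t))"
proof -
  have R: "1 / of_nat t \<in> R_ring S" by (rule R_ring_inverse_S_number[OF assms(3)])
  have nat: "norm (\<psi> (of_nat m * (1 / of_nat t)) - \<phi> (of_nat m * (1 / of_nat t)))
           \<le> m * norm (\<psi> (1 / of_nat t) - \<phi> (1 / of_nat t))" for m
    unfolding characters_of_nat_mult[OF assms(1) R] characters_of_nat_mult[OF assms(2) R]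
    by (rule norm_power_diff) (use characters_norm assms R in \<open>auto simp: less_imp_le\<close>)
  show ?thesis
  proof (cases "j \<ge> 0")
    case True
    then obtain m where "j = int m" using nonneg_int_cases by blast
    then show ?thesis using nat[of m] by simp
  next
    case False
    then obtain m where j: "j = - int m" by (metis int_cases4 le_minus_iff neg_0_le_iff_le nle_le of_nat_0_le_iff)
    have m: "(of_int j :: rat) / of_nat t = - (of_nat m * (1 / of_nat t))" using j by simp
    have "norm (cnj a - cnj b) = norm (a - b)" for a b
      by (metis complex_cnj_diff complex_mod_cnj)
    then show ?thesis
      using nat[of m] R_ring_mult[OF R_ring_of_nat[of m] R]
      unfolding m using assms by (simp add: characters_uminus j)
  qed
qed

lemma dual_topology_continuous_eval:
  assumes "r \<in> G"
  shows "continuous_map (dual_topology G) euclidean (\<lambda>\<phi>. \<phi> r)"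
  unfolding dual_topology_def
  using continuous_map_product_projection[OF assms, of "\<lambda>_. top_of_set (sphere 0 1 :: complex set)"]
  by (rule continuous_map_from_subtopology[OF continuous_map_into_fulltopology])

text \<open>A basic neighbourhood restricts only the finitely many coordinates in \<open>F\<close>.
  All of them are integer multiples of one \<open>1/t\<close>, so closeness at \<open>1/t\<close>
  forces closeness at each.\<close>

lemma open_cover_local_coordinate:
  assumes U: "openin (dual_topology (R_ring S)) U" and phi: "\<phi> \<in> U"
  obtains t d where "S_number S t" "d > 0"
    "\<And>\<psi>. \<psi> \<in> characters (R_ring S) \<Longrightarrow> norm (\<psi> (1 / of_nat t) - \<phi> (1 / of_nat t)) < d \<Longrightarrow> \<psi> \<in> U"
proof -
  let ?R = "R_ring S" and ?X = "characters (R_ring S)"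
  let ?C = "top_of_set (sphere 0 1 :: complex set)"
  obtain W where W: "openin (product_topology (\<lambda>_. ?C) ?R) W" "U = W \<inter> ?X"
    using U by (auto simp: dual_topology_def openin_subtopology)
  have phiX: "\<phi> \<in> ?X" using W(2) phi by blast
  obtain V where V: "finite {r\<in>?R. V r \<noteq> topspace ?C}" "\<forall>r\<in>?R. openin ?C (V r)"
     "\<phi> \<in> Pi\<^sub>E ?R V" "Pi\<^sub>E ?R V \<subseteq> W"
  proof -
    have "\<phi> \<in> W" using phi W(2) by blast
    with W(1) have "\<exists>V. finite {r\<in>?R. V r \<noteq> topspace ?C} \<and> (\<forall>r\<in>?R. openin ?C (V r)) \<and>
        \<phi> \<in> Pi\<^sub>E ?R V \<and> Pi\<^sub>E ?R V \<subseteq> W"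
      unfolding openin_product_topology_alt by (rule bspec)
    then show ?thesis by (elim exE conjE) (rule that)
  qed
  define F where "F = {r\<in>?R. V r \<noteq> topspace ?C}"
  have "\<exists>e>0. \<forall>z\<in>sphere 0 1. dist z (\<phi> r) < e \<longrightarrow> z \<in> V r" if "r \<in> ?R" for r
  proof -
    have "\<phi> r \<in> V r" using V(3) that by (rule PiE_mem)
    moreover have "openin ?C (V r)" using V(2) that by (rule bspec)
    ultimately show ?thesis by (simp add: openin_euclidean_subtopology_iff)
  qed
  then obtain e where e: "\<And>r. r \<in> ?R \<Longrightarrow> e r > 0"
    "\<And>r z. r \<in> ?R \<Longrightarrow> z \<in> sphere 0 1 \<Longrightarrow> dist z (\<phi> r) < e r \<Longrightarrow> z \<in> V r" by metis
  obtain t where t: "S_number S t" "\<forall>r\<in>F. \<exists>j. r = of_int j / of_nat t"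
    using common_denominator[of F S] V(1) by (auto simp: F_def)
  obtain j where j: "\<And>r. r \<in> F \<Longrightarrow> r = of_int (j r) / of_nat t" using t(2) by metis
  \<comment> \<open>The \<open>+ 1\<close> avoids a zero denominator at \<open>j r = 0\<close> and
    later yields the strict inequality.\<close>
  have "\<exists>d>0. \<forall>r\<in>F. d \<le> e r / (\<bar>of_int (j r)\<bar> + 1)"
    using V(1) e(1) by (intro uniform_lower_bound) (auto simp: F_def intro!: divide_pos_pos)
  then obtain d where d: "d > 0" "\<And>r. r \<in> F \<Longrightarrow> d \<le> e r / (\<bar>of_int (j r)\<bar> + 1)" by blast
  show thesis
  proof (rule that[OF t(1) d(1)])
    fix \<psi> assume psi: "\<psi> \<in> ?X" and less: "norm (\<psi> (1 / of_nat t) - \<phi> (1 / of_nat t)) < d"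
    have "\<psi> r \<in> V r" if r: "r \<in> ?R" for r
    proof (cases "r \<in> F")
      case False
      then show ?thesis using r psi by (auto simp: F_def characters_norm)
    next
      case True
      have "norm (\<psi> r - \<phi> r) \<le> \<bar>of_int (j r)\<bar> * norm (\<psi> (1 / of_nat t) - \<phi> (1 / of_nat t))"
        using norm_character_diff_le[OF phiX psi t(1), of "j r"] j[OF True] by metis
      also have "\<dots> \<le> \<bar>of_int (j r)\<bar> * d" using less by (intro mult_left_mono) auto
      also have "\<dots> < (\<bar>of_int (j r)\<bar> + 1) * d" using d(1) by (simp add: distrib_right)
      also have "\<dots> \<le> e r" using d(2)[OF True] by (simp add: field_simps)
      finally show ?thesis using e(2)[OF r, of "\<psi> r"] r psi by (auto simp: dist_norm characters_norm)
    qed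
    then have "\<psi> \<in> Pi\<^sub>E ?R V" using psi by (auto simp: characters_def PiE_def)
    then show "\<psi> \<in> U" using V(4) W(2) psi by blast
  qed
qed

text \<open>A Lebesgue number for open covers, measured in a single coordinate.\<close>

lemma open_cover_uniform_coordinate:
  assumes "open_cover (dual_topology (R_ring S)) \<U>"
  obtains t \<delta> where "S_number S t" "\<delta> > 0"
    "\<And>\<phi>. \<phi> \<in> characters (R_ring S) \<Longrightarrow> \<exists>U\<in>\<U>. \<forall>\<psi>\<in>characters (R_ring S).
        norm (\<psi> (1 / of_nat t) - \<phi> (1 / of_nat t)) < \<delta> \<longrightarrow> \<psi> \<in> U"
proof -
  let ?R = "R_ring S" and ?X = "characters (R_ring S)"
  have "\<exists>t d U. S_number S t \<and> d > 0 \<and> U \<in> \<U> \<and>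
     (\<forall>\<psi>\<in>?X. norm (\<psi> (1 / of_nat t) - \<phi> (1 / of_nat t)) < 2 * d \<longrightarrow> \<psi> \<in> U)" if "\<phi> \<in> ?X" for \<phi>
  proof -
    have "\<phi> \<in> \<Union>\<U>"
      using assms that by (simp add: open_cover_def topspace_dual_topology)
    then obtain U where U: "U \<in> \<U>" "\<phi> \<in> U" by (rule UnionE)
    have openU: "openin (dual_topology ?R) U"
      using assms U(1) by (simp add: open_cover_def)
    obtain t d where td: "S_number S t" "d > 0"
      "\<And>\<psi>. \<psi> \<in> ?X \<Longrightarrow> norm (\<psi> (1 / of_nat t) - \<phi> (1 / of_nat t)) < d \<Longrightarrow> \<psi> \<in> U"
      using open_cover_local_coordinate[OF openU U(2)] by blast
    show ?thesis
      by (rule exI[of _ t], rule exI[of _ "d / 2"], rule exI[of _ U]) (use td U in auto)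
  qed
  then obtain t d U where loc: "\<And>\<phi>. \<phi> \<in> ?X \<Longrightarrow> S_number S (t \<phi>)" "\<And>\<phi>. \<phi> \<in> ?X \<Longrightarrow> d \<phi> > 0"
    "\<And>\<phi>. \<phi> \<in> ?X \<Longrightarrow> U \<phi> \<in> \<U>" "\<And>\<phi> \<psi>. \<phi> \<in> ?X \<Longrightarrow> \<psi> \<in> ?X \<Longrightarrow>
       norm (\<psi> (1 / of_nat (t \<phi>)) - \<phi> (1 / of_nat (t \<phi>))) < 2 * d \<phi> \<Longrightarrow> \<psi> \<in> U \<phi>"
    by metis
  \<comment> \<open>The local neighbourhoods have radius \<open>2 * d\<close>, so a ball of radius
    \<open>d\<close> leaves another \<open>d\<close> for the distance from \<open>\<phi>\<close> to
    \<open>\<psi>\<close>. Compactness then leaves finitely many centres and hence one common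
    denominator.\<close>
  define B where "B \<phi> = {\<psi> \<in> topspace (dual_topology ?R).
      \<psi> (1 / of_nat (t \<phi>)) \<in> ball (\<phi> (1 / of_nat (t \<phi>))) (d \<phi>)}" for \<phi>
  have openB: "openin (dual_topology ?R) (B \<phi>)" if "\<phi> \<in> ?X" for \<phi>
    unfolding B_def using loc(1)[OF that]
    by (intro openin_continuous_map_preimage[OF dual_topology_continuous_eval])
       (auto intro: R_ring_inverse_S_number)
  have "?X \<subseteq> \<Union>(B ` ?X)"
    using loc(2) by (force simp: B_def topspace_dual_topology)
  then have "\<exists>\<F>. finite \<F> \<and> \<F> \<subseteq> B ` ?X \<and> ?X \<subseteq> \<Union>\<F>"
    using compact_dual_topology[of S] openB unfolding compact_space_alt topspace_dual_topology by auto
  then obtain \<F> where F: "finite \<F>" "\<F> \<subseteq> B ` ?X" "?X \<subseteq> \<Union>\<F>" by blast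
  obtain \<Phi> where "\<Phi> \<subseteq> ?X" "finite \<Phi>" "\<F> = B ` \<Phi>"
    using finite_subset_image[OF F(1,2)] by blast
  with F(3) have Phi: "finite \<Phi>" "\<Phi> \<subseteq> ?X" "?X \<subseteq> \<Union>(B ` \<Phi>)"
    by simp_all
  have "(\<lambda>\<phi>. 1 / of_nat (t \<phi>)) ` \<Phi> \<subseteq> ?R"
  proof (rule image_subsetI)
    fix \<xi> assume "\<xi> \<in> \<Phi>"
    then have "\<xi> \<in> ?X" using Phi(2) by (rule rev_subsetD)
    then show "1 / of_nat (t \<xi>) \<in> ?R" by (rule R_ring_inverse_S_number[OF loc(1)])
  qed
  from common_denominator[OF finite_imageI[OF Phi(1)] this]
  obtain t0 where t0: "S_number S t0" "\<forall>\<xi>\<in>\<Phi>. \<exists>j. 1 / of_nat (t \<xi>) = (of_int j :: rat) / of_nat t0"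
    by auto
  obtain j where j: "\<And>\<xi>. \<xi> \<in> \<Phi> \<Longrightarrow> 1 / of_nat (t \<xi>) = (of_int (j \<xi>) :: rat) / of_nat t0" using t0(2) by metis
  have "d \<xi> / (\<bar>of_int (j \<xi>)\<bar> + 1) > 0" if "\<xi> \<in> \<Phi>" for \<xi>
    using loc(2)[of \<xi>] Phi(2) that by (auto intro!: divide_pos_pos)
  then have "\<exists>\<delta>>0. \<forall>\<xi>\<in>\<Phi>. \<delta> \<le> d \<xi> / (\<bar>of_int (j \<xi>)\<bar> + 1)"
    by (rule uniform_lower_bound[OF Phi(1)])
  then obtain \<delta> where \<delta>: "\<delta> > 0" "\<And>\<xi>. \<xi> \<in> \<Phi> \<Longrightarrow> \<delta> \<le> d \<xi> / (\<bar>of_int (j \<xi>)\<bar> + 1)" by blast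
  show thesis
  proof (rule that[OF t0(1) \<delta>(1)])
    fix \<phi> assume phi: "\<phi> \<in> ?X"
    then obtain \<xi> where xi: "\<xi> \<in> \<Phi>" "\<phi> \<in> B \<xi>" using Phi(3) by blast
    have xiX: "\<xi> \<in> ?X" using xi Phi(2) by blast
    have "\<psi> \<in> U \<xi>" if psi: "\<psi> \<in> ?X" and less: "norm (\<psi> (1 / of_nat t0) - \<phi> (1 / of_nat t0)) < \<delta>" for \<psi>
    proof -
      let ?r = "1 / of_nat (t \<xi>) :: rat"
      have "norm (\<psi> ?r - \<phi> ?r) \<le> \<bar>of_int (j \<xi>)\<bar> * norm (\<psi> (1 / of_nat t0) - \<phi> (1 / of_nat t0))"
        using norm_character_diff_le[OF phi psi t0(1), of "j \<xi>"] j[OF xi(1)] by metis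
      also have "\<dots> \<le> \<bar>of_int (j \<xi>)\<bar> * \<delta>" using less by (intro mult_left_mono) auto
      also have "\<dots> \<le> (\<bar>of_int (j \<xi>)\<bar> + 1) * \<delta>" using \<delta>(1) by (simp add: distrib_right)
      also have "\<dots> \<le> d \<xi>" using \<delta>(2)[OF xi(1)] by (simp add: field_simps)
      finally have "norm (\<psi> ?r - \<phi> ?r) \<le> d \<xi>" .
      moreover have "norm (\<phi> ?r - \<xi> ?r) < d \<xi>" using xi(2) by (auto simp: B_def dist_norm norm_minus_commute)
      ultimately have "norm (\<psi> ?r - \<xi> ?r) < 2 * d \<xi>"
        using norm_triangle_ineq[of "\<psi> ?r - \<phi> ?r" "\<phi> ?r - \<xi> ?r"] by simp
      then show ?thesis using loc(4)[OF xiX psi] by blast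
    qed
    then show "\<exists>U\<in>\<U>. \<forall>\<psi>\<in>?X. norm (\<psi> (1 / of_nat t0) - \<phi> (1 / of_nat t0)) < \<delta> \<longrightarrow> \<psi> \<in> U"
      using loc(3)[OF xiX] by blast
  qed
qed

subsection \<open>Topological entropy\<close>

lemma norm_cis_diff_le: "norm (cis a - cis b) \<le> \<bar>a - b\<bar>"
proof -
  have "cis a - cis b = cis b * (cis (a - b) - 1)" by (simp add: right_diff_distrib cis_mult)
  then have "norm (cis a - cis b) = norm (cis (a - b) - 1)" by (simp add: norm_mult)
  also have "\<dots> = 2 * \<bar>sin ((a - b) / 2)\<bar>"
    using dist_exp_i_1[of "a - b"] by (simp add: cis_conv_exp)
  also have "\<dots> \<le> \<bar>a - b\<bar>" using abs_sin_x_le_abs_x[of "(a - b) / 2"] by simp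
  finally show ?thesis .
qed

lemma cover_number_le:
  assumes "\<V> \<subseteq> \<U>" "finite \<V>" "\<Union>\<V> = topspace X"
  shows "cover_number X \<U> \<le> card \<V>"
  unfolding cover_number_def using assms by (intro Least_le) blast

text \<open>A \<open>LEAST\<close> says nothing until some witness exists, so one finite subcover
  has to be given before the cover number can be bounded from below.\<close>

lemma cover_number_attained:
  assumes "\<V> \<subseteq> \<U>" "finite \<V>" "\<Union>\<V> = topspace X"
  shows "\<exists>\<W>\<subseteq>\<U>. finite \<W> \<and> card \<W> = cover_number X \<U> \<and> \<Union>\<W> = topspace X"
  unfolding cover_number_def
  by (rule LeastI_ex[where P = "\<lambda>k. \<exists>\<V>\<subseteq>\<U>. finite \<V> \<and> card \<V> = k \<and> \<Union>\<V> = topspace X"])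
     (use assms in blast)

text \<open>Initial points whose coordinate at \<open>1/t\<close> agrees up to \<open>\<delta>/2\<^sup>n\<close> stay \<open>\<delta>\<close>-close for \<open>n\<close> steps,
  so about \<open>2\<pi>\<cdot>2\<^sup>n/\<delta>\<close> arcs suffice.\<close>

lemma join_cover_subcover:
  assumes cover: "open_cover (dual_topology (R_ring S)) \<U>"
  shows "\<exists>C>0. \<forall>n. \<exists>\<V>\<subseteq>join_cover (dual_topology (R_ring S)) (T_map S) \<U> n.
           finite \<V> \<and> real (card \<V>) \<le> C * 2 ^ n \<and> \<Union>\<V> = topspace (dual_topology (R_ring S))"
proof -
  let ?R = "R_ring S" and ?X = "characters (R_ring S)" and ?T = "T_map S"
  obtain t \<delta> where t: "S_number S t" and \<delta>: "\<delta> > 0" and unif: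
    "\<And>\<phi>. \<phi> \<in> ?X \<Longrightarrow> \<exists>U\<in>\<U>. \<forall>\<psi>\<in>?X.
        norm (\<psi> (1 / of_nat t) - \<phi> (1 / of_nat t)) < \<delta> \<longrightarrow> \<psi> \<in> U"
    using open_cover_uniform_coordinate[OF cover] by blast
  define r :: rat where "r = 1 / of_nat t"
  have r: "r \<in> ?R" unfolding r_def by (rule R_ring_inverse_S_number[OF t])
  have "\<forall>\<phi>. \<exists>U. \<phi> \<in> ?X \<longrightarrow> U \<in> \<U> \<and> (\<forall>\<psi>\<in>?X. norm (\<psi> r - \<phi> r) < \<delta> \<longrightarrow> \<psi> \<in> U)"
    using unif unfolding r_def by blast
  then obtain U where U: "\<And>\<phi>. \<phi> \<in> ?X \<Longrightarrow> U \<phi> \<in> \<U>"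
    "\<And>\<phi> \<psi>. \<phi> \<in> ?X \<Longrightarrow> \<psi> \<in> ?X \<Longrightarrow> norm (\<psi> r - \<phi> r) < \<delta> \<Longrightarrow> \<psi> \<in> U \<phi>" by metis
  \<comment> \<open>Arcs of length \<open>2 * pi / K\<close> must stay shorter than
    \<open>\<delta>\<close> after \<open>n\<close> doublings, so \<open>K\<close> has to exceed
    \<open>2 * pi * 2 ^ n / \<delta>\<close>. The summand \<open>1\<close> pays for rounding down,
    since \<open>1 \<le> 2 ^ n\<close>.\<close>
  define C where "C = 2 * pi / \<delta> + 1"
  have C: "C > 0" using \<delta> by (simp add: C_def add_pos_pos)
  have "\<exists>\<V>\<subseteq>join_cover (dual_topology ?R) ?T \<U> n.
           finite \<V> \<and> real (card \<V>) \<le> C * 2 ^ n \<and> \<Union>\<V> = topspace (dual_topology ?R)" for n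
  proof -
    define K where "K = nat \<lfloor>C * 2 ^ n\<rfloor>"
    have K_le: "real K \<le> C * 2 ^ n" using C by (simp add: K_def)
    have "(1::real) \<le> 2 ^ n" by simp
    then have "2 * pi / \<delta> * 2 ^ n + 1 \<le> C * 2 ^ n" unfolding C_def by (simp add: distrib_right)
    moreover have "C * 2 ^ n < real K + 1" using C unfolding K_def by (simp add: of_nat_nat)
    ultimately have K_gt: "2 * pi / \<delta> * 2 ^ n < real K" by linarith
    moreover have "2 * pi / \<delta> * 2 ^ n > 0" using \<delta> by simp
    ultimately have K0: "K > 0" by (metis of_nat_0_less_iff less_trans)
    \<comment> \<open>Scaling by \<open>t\<close> makes the value at \<open>1/t\<close> equal to the
      \<open>k\<close>-th of the \<open>K\<close> equally spaced points on the circle.\<close>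
    define c where "c k = exp_character S (real t * real k / real K)" for k
    have c_in: "(?T ^^ i) (c k) \<in> ?X" for i k
      unfolding c_def by (intro T_map_funpow_characters exp_character_in)
    have c_r: "c k r = cis (2 * pi * (real k / real K))" for k
      using r S_number_pos[OF t] unfolding c_def
      by (simp add: exp_character_apply) (simp add: r_def of_rat_divide mult.assoc)
    define W where "W k = {x \<in> topspace (dual_topology ?R). \<forall>i<n. (?T ^^ i) x \<in> U ((?T ^^ i) (c k))}" for k
    have "W ` {..<K} \<subseteq> join_cover (dual_topology ?R) ?T \<U> n"
    proof (rule image_subsetI)
      fix k
      show "W k \<in> join_cover (dual_topology ?R) ?T \<U> n"
        unfolding join_cover_def W_def mem_Collect_eq
        by (rule exI[of _ "\<lambda>i. U ((?T ^^ i) (c k))"]) (use U(1)[OF c_in] in simp)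
    qed
    moreover have "real (card (W ` {..<K})) \<le> C * 2 ^ n"
      using card_image_le[of "{..<K}" W] K_le by simp
    moreover have "\<Union>(W ` {..<K}) = topspace (dual_topology ?R)"
    proof
      show "topspace (dual_topology ?R) \<subseteq> \<Union>(W ` {..<K})"
      proof
        fix x assume x': "x \<in> topspace (dual_topology ?R)"
        then have x: "x \<in> ?X" by (simp add: topspace_dual_topology)
        obtain a where a: "0 \<le> a" "a < 2 * pi" "x r = cis a"
          using complex_norm_eq_1_exp[of "x r"] characters_norm[OF x r] Arg2pi_ge_0 Arg2pi_lt_2pi
          by (metis cis_conv_exp mult.commute)
        define \<theta> where "\<theta> = a / (2 * pi)"
        have \<theta>: "0 \<le> \<theta>" "\<theta> < 1" "x r = cis (2 * pi * \<theta>)" using a by (simp_all add: \<theta>_def)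
        define k where "k = nat \<lfloor>\<theta> * real K\<rfloor>"
        have k: "real k \<le> \<theta> * real K" "\<theta> * real K < real k + 1" using \<theta>(1) by (auto simp: k_def)
        have kK: "k < K"
        proof -
          have "\<theta> * real K < real K" using \<theta>(2) K0 by simp
          then have "real k < real K" using k(1) by linarith
          then show ?thesis by simp
        qed
        have close: "norm (x r - c k r) \<le> 2 * pi / real K"
        proof -
          have "norm (x r - c k r) \<le> \<bar>2 * pi * \<theta> - 2 * pi * (real k / real K)\<bar>"
            unfolding \<theta>(3) c_r by (rule norm_cis_diff_le)
          also have "\<dots> = 2 * pi * \<bar>\<theta> - real k / real K\<bar>"
            by (simp only: right_diff_distrib[symmetric] abs_mult) simp
          also have "\<dots> \<le> 2 * pi * (1 / real K)"
          proof (rule mult_left_mono)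
            have "\<theta> - real k / real K = (\<theta> * real K - real k) / real K"
              using K0 by (simp add: diff_divide_distrib)
            then show "\<bar>\<theta> - real k / real K\<bar> \<le> 1 / real K"
              using k by (simp add: abs_divide divide_right_mono)
          qed simp
          finally show ?thesis by simp
        qed
        have "(?T ^^ i) x \<in> U ((?T ^^ i) (c k))" if i: "i < n" for i
        proof (rule U(2)[OF c_in T_map_funpow_characters[OF x]])
          have cX: "c k \<in> ?X" using c_in[of 0] by simp
          have "norm ((?T ^^ i) x r - (?T ^^ i) (c k) r) = norm (x r ^ 2 ^ i - c k r ^ 2 ^ i)"
            by (simp add: T_map_funpow_apply_power[OF x r] T_map_funpow_apply_power[OF cX r])
          also have "\<dots> \<le> real (2 ^ i) * norm (x r - c k r)"
            by (rule norm_power_diff) (simp_all add: characters_norm[OF x r] characters_norm[OF cX r])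
          also have "\<dots> \<le> 2 ^ n * (2 * pi / real K)"
            using close i by (intro mult_mono) auto
          also have "\<dots> < \<delta>" using K_gt K0 \<delta> by (simp add: field_simps)
          finally show "norm ((?T ^^ i) x r - (?T ^^ i) (c k) r) < \<delta>" .
        qed
        then have "x \<in> W k" using x' by (simp add: W_def)
        then show "x \<in> \<Union>(W ` {..<K})" using kK by blast
      qed
    qed (auto simp: W_def)
    ultimately show ?thesis by blast
  qed
  then show ?thesis using C by blast
qed

lemma cover_entropy_le_ln_2:
  assumes cover: "open_cover (dual_topology (R_ring S)) \<U>"
  shows "cover_entropy (dual_topology (R_ring S)) (T_map S) \<U> \<le> ereal (ln 2)"
proof -
  let ?D = "dual_topology (R_ring S)"
  define N where "N n = real (cover_number ?D (join_cover ?D (T_map S) \<U> n))" for n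
  obtain C where C: "C > 0" "\<And>n. N n \<le> C * 2 ^ n"
  proof -
    obtain C where C: "C > 0" "\<And>n. \<exists>\<V>\<subseteq>join_cover ?D (T_map S) \<U> n.
           finite \<V> \<and> real (card \<V>) \<le> C * 2 ^ n \<and> \<Union>\<V> = topspace ?D"
      using join_cover_subcover[OF cover] by blast
    have "N n \<le> C * 2 ^ n" for n
    proof -
      from C(2)[of n] obtain \<V> where "\<V> \<subseteq> join_cover ?D (T_map S) \<U> n" "finite \<V>"
        "real (card \<V>) \<le> C * 2 ^ n" "\<Union>\<V> = topspace ?D" by (elim exE conjE) (rule that)
      then show ?thesis using cover_number_le[of \<V> "join_cover ?D (T_map S) \<U> n" ?D]
        unfolding N_def by linarith
    qed
    then show thesis using C(1) that by blast
  qed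
  have ub: "ln (N n) / real n \<le> \<bar>ln C\<bar> / real n + ln 2" if "n > 0" for n
  proof -
    have "ln (N n) \<le> \<bar>ln C\<bar> + real n * ln 2"
    \<comment> \<open>The degenerate case is settled by the convention
      \<open>ln 0 = 0\<close>.\<close>
    proof (cases "N n = 0")
      case False
      then have "N n > 0" unfolding N_def by simp
      then have "ln (N n) \<le> ln (C * 2 ^ n)" using C by simp
      also have "\<dots> = ln C + real n * ln 2" using C(1) by (simp add: ln_mult ln_realpow)
      finally show ?thesis by linarith
    qed simp
    then show ?thesis using that by (simp add: field_simps)
  qed
  have "(\<lambda>n. \<bar>ln C\<bar> / real n + ln 2) \<longlonglongrightarrow> 0 + ln 2"
    by (intro tendsto_add lim_const_over_n tendsto_const)
  then have lim: "(\<lambda>n. ereal (\<bar>ln C\<bar> / real n + ln 2)) \<longlonglongrightarrow> ereal (ln 2)" by simp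
  have "limsup (\<lambda>n. ereal (ln (N n) / real n)) \<le> limsup (\<lambda>n. ereal (\<bar>ln C\<bar> / real n + ln 2))"
    by (intro Limsup_mono) (use ub in \<open>auto intro: eventually_sequentiallyI[of 1]\<close>)
  also have "\<dots> = ereal (ln 2)" by (rule lim_imp_Limsup[OF _ lim]) simp
  finally show ?thesis by (simp add: cover_entropy_def N_def)
qed

text \<open>The points \<open>k/2\<^sup>n\<close> of the line are separated: two of them become antipodal in the
  coordinate at \<open>1\<close> before time \<open>n\<close>, and no half circle contains antipodal points.\<close>

definition half_cover :: "nat set \<Rightarrow> (rat \<Rightarrow> complex) set set" where
  "half_cover S = (\<lambda>w. {\<phi> \<in> characters (R_ring S). Re (\<phi> 1 * cnj w) > 0}) ` sphere 0 1"

lemma open_cover_half_cover: "open_cover (dual_topology (R_ring S)) (half_cover S)"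
  unfolding open_cover_def
proof (intro conjI ballI)
  fix U assume "U \<in> half_cover S"
  then obtain w where U: "U = {\<phi> \<in> topspace (dual_topology (R_ring S)). \<phi> 1 \<in> {z. Re (z * cnj w) > 0}}"
    by (auto simp: half_cover_def topspace_dual_topology)
  have "open {z. Re (z * cnj w) > 0}"
    by (intro open_Collect_less continuous_intros)
  then show "openin (dual_topology (R_ring S)) U"
    unfolding U by (intro openin_continuous_map_preimage[OF dual_topology_continuous_eval]) simp_all
next
  show "\<Union>(half_cover S) = topspace (dual_topology (R_ring S))"
  proof
    show "topspace (dual_topology (R_ring S)) \<subseteq> \<Union>(half_cover S)"
    proof
      fix \<phi> assume "\<phi> \<in> topspace (dual_topology (R_ring S))"
      then have \<phi>: "\<phi> \<in> characters (R_ring S)" by (simp add: topspace_dual_topology)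
      have n: "norm (\<phi> 1) = 1" by (rule characters_norm[OF \<phi>]) simp
      then have "Re (\<phi> 1 * cnj (\<phi> 1)) > 0" by (simp add: complex_norm_square[symmetric])
      with \<phi> n show "\<phi> \<in> \<Union>(half_cover S)"
        unfolding half_cover_def by (intro UnionI[OF imageI[of "\<phi> 1"]]) simp_all
    qed
  qed (auto simp: half_cover_def topspace_dual_topology)
qed

text \<open>Write \<open>k - j = 2 ^ m * v\<close> with \<open>v\<close> odd. After
  \<open>n - 1 - m\<close> doublings the two angles differ by \<open>pi * v\<close>, an odd multiple
  of a half turn.\<close>

lemma dyadic_antipodal:
  assumes "j < k" "k < 2 ^ n"
  shows "\<exists>i<n. cis (2 * pi * (real k / 2 ^ n)) ^ 2 ^ i = - (cis (2 * pi * (real j / 2 ^ n)) ^ 2 ^ i)"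
proof -
  have "k - j \<noteq> 0" using assms by simp
  then obtain v where v: "k - j = 2 ^ multiplicity 2 (k - j) * v" "odd v"
    using multiplicity_decompose'[of "k - j" 2] by auto
  define m where "m = multiplicity 2 (k - j)"
  have "2 ^ m \<le> k - j" using v odd_pos[OF v(2)] unfolding m_def
    by (metis dvd_imp_le dvd_triv_left \<open>k - j \<noteq> 0\<close> neq0_conv)
  also have "\<dots> < 2 ^ n" using assms by simp
  finally have mn: "m < n" by simp
  define i where "i = n - 1 - m"
  have n: "n = Suc (i + m)" using mn by (simp add: i_def)
  have kj: "real k = real j + 2 ^ m * real v"
    using v(1) assms(1) unfolding m_def[symmetric]
    by (metis add.commute le_add_diff_inverse2 less_imp_le of_nat_add of_nat_mult of_nat_numeral of_nat_power)
  have pow: "(2::real) ^ n = 2 * (2 ^ i * 2 ^ m)" unfolding n by (simp add: power_add)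
  have "real (2 ^ i) * (2 * pi * (real k / 2 ^ n)) = 2 ^ i * (2 * pi * (real j / 2 ^ n)) + pi * real v"
    unfolding kj pow by (simp add: field_simps)
  then have "cis (2 * pi * (real k / 2 ^ n)) ^ 2 ^ i
      = cis (2 ^ i * (2 * pi * (real j / 2 ^ n)) + pi * real v)"
    by (simp only: Complex.DeMoivre)
  also have "\<dots> = cis (2 ^ i * (2 * pi * (real j / 2 ^ n))) * cis pi ^ v"
    unfolding Complex.DeMoivre cis_mult by (simp only: mult.commute)
  also have "\<dots> = - cis (2 ^ i * (2 * pi * (real j / 2 ^ n)))" using v(2) by simp
  finally show ?thesis unfolding Complex.DeMoivre n
    by (intro exI[of _ i]) simp
qed

text \<open>A member of the join contains at most one of the \<open>2 ^ n\<close> points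
  \<open>c k\<close>: otherwise some open half circle would contain both \<open>z\<close> and
  \<open>- z\<close>. Hence every subcover has at least \<open>2 ^ n\<close> members.\<close>

lemma ln_2_le_cover_entropy_half_cover:
  "ereal (ln 2) \<le> cover_entropy (dual_topology (R_ring S)) (T_map S) (half_cover S)"
proof -
  let ?D = "dual_topology (R_ring S)" and ?T = "T_map S"
  have card: "2 ^ n \<le> cover_number ?D (join_cover ?D ?T (half_cover S) n)" for n
  proof -
    let ?J = "join_cover ?D ?T (half_cover S) n"
    obtain C where "C > 0" and C: "\<forall>n. \<exists>\<V>\<subseteq>join_cover ?D ?T (half_cover S) n.
        finite \<V> \<and> real (card \<V>) \<le> C * 2 ^ n \<and> \<Union>\<V> = topspace ?D"
      using join_cover_subcover[OF open_cover_half_cover, of S] by (elim exE conjE) (rule that)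
    from C[rule_format, of n] obtain \<V> where "\<V> \<subseteq> ?J" "finite \<V>" "\<Union>\<V> = topspace ?D"
      by (elim exE conjE) (rule that)
    from cover_number_attained[OF this]
    obtain \<W> where W: "\<W> \<subseteq> ?J" "finite \<W>" "card \<W> = cover_number ?D ?J" "\<Union>\<W> = topspace ?D"
      by (elim exE conjE) (rule that)
    define c where "c k = exp_character S (real k / 2 ^ n)" for k :: nat
    have c: "c k \<in> characters (R_ring S)" for k unfolding c_def by (rule exp_character_in)
    have c1: "c k 1 = cis (2 * pi * (real k / 2 ^ n))" for k
      by (simp add: c_def exp_character_apply)
    have "c k \<in> \<Union>\<W>" for k
      unfolding W(4) topspace_dual_topology by (rule c)
    then have "\<forall>k. \<exists>V. V \<in> \<W> \<and> c k \<in> V" by blast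
    then obtain V where V: "\<And>k. V k \<in> \<W>" "\<And>k. c k \<in> V k" by metis
    have neq: "V j \<noteq> V k" if jk: "j < k" "k < 2 ^ n" for j k
    proof
      assume eq: "V j = V k"
      obtain f where f: "V k = {x \<in> topspace ?D. \<forall>i<n. (?T ^^ i) x \<in> f i}" "\<forall>i<n. f i \<in> half_cover S"
        using subsetD[OF W(1) V(1)[of k]] unfolding join_cover_def
        by (elim CollectE exE conjE) (rule that)
      obtain i where i: "i < n" "c k 1 ^ 2 ^ i = - (c j 1 ^ 2 ^ i)"
        using dyadic_antipodal[OF jk] unfolding c1 by blast
      obtain w where w: "f i = {\<phi> \<in> characters (R_ring S). Re (\<phi> 1 * cnj w) > 0}"
        using f(2) i(1) by (auto simp: half_cover_def)
      have "Re (c l 1 ^ 2 ^ i * cnj w) > 0" if "c l \<in> V k" for l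
      proof -
        have "(?T ^^ i) (c l) \<in> f i" using that i(1) unfolding f(1) by simp
        then show ?thesis using w T_map_funpow_apply_power[OF c, of 1] by simp
      qed
      then have "Re (c j 1 ^ 2 ^ i * cnj w) > 0" "Re (c k 1 ^ 2 ^ i * cnj w) > 0"
        using V(2) eq by metis+
      then show False unfolding i(2) by simp
    qed
    have "inj_on V {..<2 ^ n}"
      by (rule linorder_inj_onI) (use neq in auto)
    then have "card {..<(2::nat) ^ n} \<le> card \<W>"
      using V(1) W(2) by (intro card_inj_on_le) auto
    then show ?thesis using W(3) by simp
  qed
  have "ln 2 \<le> ln (real (cover_number ?D (join_cover ?D ?T (half_cover S) n))) / real n" if "n > 0" for n
  proof -
    have "real (2 ^ n) \<le> real (cover_number ?D (join_cover ?D ?T (half_cover S) n))"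
      using card[of n] by (rule of_nat_mono)
    then have "ln (2 ^ n) \<le> ln (real (cover_number ?D (join_cover ?D ?T (half_cover S) n)))"
      by (intro ln_mono) auto
    then show ?thesis using that by (simp add: ln_realpow field_simps)
  qed
  then show ?thesis unfolding cover_entropy_def
    by (intro le_Limsup) (auto intro: eventually_sequentiallyI[of 1])
qed

lemma topological_entropy_T_map:
  "topological_entropy (dual_topology (R_ring S)) (T_map S) = ereal (ln 2)"
  unfolding topological_entropy_def
proof (rule antisym)
  show "(SUP \<U>\<in>{\<U>. open_cover (dual_topology (R_ring S)) \<U>}.
           cover_entropy (dual_topology (R_ring S)) (T_map S) \<U>) \<le> ereal (ln 2)"
    by (rule SUP_least) (simp add: cover_entropy_le_ln_2)
  show "ereal (ln 2) \<le> (SUP \<U>\<in>{\<U>. open_cover (dual_topology (R_ring S)) \<U>}.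
           cover_entropy (dual_topology (R_ring S)) (T_map S) \<U>)"
    by (rule SUP_upper2[of "half_cover S"])
       (simp_all add: open_cover_half_cover ln_2_le_cover_entropy_half_cover)
qed

subsection \<open>Periodic points\<close>

definition S_part :: "nat set \<Rightarrow> nat \<Rightarrow> nat" where
  "S_part S m = (\<Prod>p\<in>S. p ^ multiplicity p m)"

text \<open>One prime is split off at a time. The powers already removed are prime to the new
  \<open>p\<close>, so the cofactor still carries the full power of \<open>p\<close> in
  \<open>m\<close>.\<close>

lemma S_part_decomposition:
  assumes "finite S" "\<And>p. p \<in> S \<Longrightarrow> prime p" "m > 0"
  shows "\<exists>b. m = b * S_part S m \<and> (\<forall>p\<in>S. \<not> p dvd b)"
  using assms(1,2)
proof (induction S rule: finite_induct)
  case (insert p S)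
  then obtain b where b: "m = b * S_part S m" "\<forall>q\<in>S. \<not> q dvd b" by auto
  have p: "prime p" using insert.prems by simp
  have b0: "b > 0" "S_part S m > 0" using b(1) assms(3) by (metis gr0I mult_is_0)+
  have "\<not> p dvd S_part S m"
  proof
    assume "p dvd S_part S m"
    then obtain q where q: "q \<in> S" "p dvd q ^ multiplicity q m"
      using p insert.hyps(1) unfolding S_part_def by (auto simp: prime_dvd_prod_iff)
    then have "p dvd q" using p prime_dvd_power by blast
    then show False using q(1) insert.hyps(2) insert.prems p primes_dvd_imp_eq by blast
  qed
  then have "multiplicity p (b * S_part S m) = multiplicity p b"
    using p b(1) b0 assms(3)
    by (subst prime_elem_multiplicity_mult_distrib) (auto simp: not_dvd_imp_multiplicity_0)
  then have mult: "multiplicity p m = multiplicity p b" using b(1) by simp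
  obtain c where c: "b = p ^ multiplicity p b * c" "\<not> p dvd c"
    using multiplicity_decompose'[of b p] b0 p not_prime_unit by (metis gr_implies_not0)
  have "m = c * S_part (insert p S) m"
  proof -
    have "S_part (insert p S) m = p ^ multiplicity p b * S_part S m"
      using insert.hyps mult by (simp add: S_part_def)
    then show ?thesis using b(1) c(1) by (metis mult.assoc mult.commute)
  qed
  moreover have "\<not> q dvd c" if "q \<in> insert p S" for q
    using that b(2) c by (metis dvd_mult insert_iff)
  ultimately show ?case by blast
qed (simp add: S_part_def)

lemma S_number_S_part: "finite S \<Longrightarrow> (\<And>p. p \<in> S \<Longrightarrow> prime p) \<Longrightarrow> S_number S (S_part S m)"
  unfolding S_part_def
proof (intro S_number_prod)
  fix q assume q: "q \<in> S" and primes: "\<And>p. p \<in> S \<Longrightarrow> prime p"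
  have "p = q" if "prime p" "p dvd q ^ k" for p k
    using primes_dvd_imp_eq[OF that(1) primes[OF q] prime_dvd_power[OF that]] .
  then show "S_number S (q ^ multiplicity q m)"
    using q prime_gt_0_nat[OF primes[OF q]] unfolding S_number_def by simp metis
qed

section \<open>Residues of S-integers modulo \<open>b\<close>\<close>

lemma coprime_S_number:
  assumes "S_number S t" "\<And>p. p \<in> S \<Longrightarrow> \<not> p dvd b"
  shows "coprime t b"
proof (rule ccontr)
  assume "\<not> coprime t b"
  then have "gcd t b \<noteq> 1" by (simp add: coprime_iff_gcd_eq_1)
  then obtain p where "prime p" "p dvd gcd t b" using prime_factor_nat by blast
  then show False using assms by (auto simp: S_number_def)
qed

text \<open>\<open>b\<close> is coprime to every admissible denominator, so it cannot be cancelled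
  by one. In other words, \<open>Z / b Z\<close> embeds into \<open>R_S / b R_S\<close>.\<close>

lemma dvd_of_div_in_R_ring:
  assumes b: "b > 0" "\<And>p. p \<in> S \<Longrightarrow> \<not> p dvd b" and x: "of_int x / of_nat b \<in> R_ring S"
  shows "int b dvd x"
proof -
  obtain j t where t: "S_number S t" "of_int x / of_nat b = (of_int j :: rat) / of_nat t"
    using x by (auto simp: in_R_ring_iff)
  then have "(of_int x :: rat) * of_nat t = of_int j * of_nat b"
    using b(1) S_number_pos[OF t(1)] by (simp add: field_simps)
  then have "x * int t = j * int b" by (metis of_int_eq_iff of_int_mult of_int_of_nat_eq)
  then have "int b dvd x * int t" by simp
  moreover have "coprime (int b) (int t)"
    using coprime_S_number[OF t(1) b(2)] by (simp add: coprime_commute)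
  ultimately show ?thesis by (simp add: coprime_dvd_mult_left_iff)
qed

text \<open>Admissible denominators are units modulo \<open>b\<close>, so every class of
  \<open>R_S / b R_S\<close> contains a natural number. This is the surjectivity complementing the
  preceding embedding.\<close>

lemma R_ring_residue:
  assumes b: "b > 0" "\<And>p. p \<in> S \<Longrightarrow> \<not> p dvd b" and r: "r \<in> R_ring S"
  shows "\<exists>c::nat. (r - of_nat c) / of_nat b \<in> R_ring S"
proof -
  obtain j t where t: "S_number S t" "r = of_int j / of_nat t"
    using r by (auto simp: in_R_ring_iff)
  have "coprime (int t) (int b)" using coprime_S_number[OF t(1) b(2)] by simp
  then obtain u v where uv: "u * int t + v * int b = 1"
    using bezout_int[of "int t" "int b"] by auto
  \<comment> \<open>By the Bezout relation \<open>u\<close> inverts \<open>t\<close> modulo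
    \<open>b\<close>, so \<open>j * u\<close> represents \<open>j / t\<close>.\<close>
  define c where "c = nat ((j * u) mod int b)"
  have c: "int c = (j * u) mod int b" using b(1) by (simp add: c_def)
  have "j * u = int b * ((j * u) div int b) + int c" unfolding c by simp
  then have ju: "(of_int j * of_int u :: rat) = of_nat b * of_int ((j * u) div int b) + of_nat c"
    by (metis of_int_add of_int_mult of_int_of_nat_eq)
  have "(of_int u * of_nat t + of_int v * of_nat b :: rat) = of_int (u * int t + v * int b)" by simp
  then have uv': "(of_int u * of_nat t + of_int v * of_nat b :: rat) = 1" unfolding uv by simp
  have t0: "(of_nat t :: rat) \<noteq> 0" using S_number_pos[OF t(1)] by simp
  have b0: "(of_nat b :: rat) \<noteq> 0" using b(1) by simp
  have "r = of_int j * (of_int u * of_nat t + of_int v * of_nat b) / of_nat t"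
    unfolding uv' t(2) by simp
  also have "\<dots> = of_int j * of_int u + of_nat b * (of_int (j * v) / of_nat t)"
    using t0 by (simp add: field_simps)
  finally have "r - of_nat c = of_nat b * (of_int ((j * u) div int b) + of_int (j * v) / of_nat t)"
    unfolding ju by (simp add: algebra_simps)
  then have "(r - of_nat c) / of_nat b = of_int ((j * u) div int b) + of_int (j * v) / of_nat t"
    using b0 by (simp del: of_int_mult)
  moreover have "of_int (j * v) / of_nat t \<in> R_ring S" using t(1) in_R_ring_iff by blast
  ultimately show ?thesis using R_ring_add[OF R_ring_of_int] by metis
qed

lemma root_of_unity_power_cong:
  assumes "(\<zeta>::complex) ^ b = 1" "int b dvd int x - int y"
  shows "\<zeta> ^ x = \<zeta> ^ y"
proof -
  have *: "\<zeta> ^ x = \<zeta> ^ y" if "int b dvd int x - int y" "y \<le> x" for x y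
  proof -
    have "b dvd x - y" using that by (metis int_dvd_int_iff of_nat_diff)
    then obtain k where "x - y = b * k" by (rule dvdE)
    then have "x = y + b * k" using that(2) by simp
    then show ?thesis using assms(1) by (simp add: power_add power_mult)
  qed
  show ?thesis
  proof (cases "y \<le> x")
    case False
    then show ?thesis using *[of y x] assms(2) by (simp add: dvd_diff_commute)
  qed (rule *[OF assms(2)])
qed

definition periodic_points :: "'a set \<Rightarrow> ('a \<Rightarrow> 'a) \<Rightarrow> nat \<Rightarrow> 'a set" where
  "periodic_points X T n = {x \<in> X. (T ^^ n) x = x}"

text \<open>A fixed point of the \<open>n\<close>-th iterate is a character that is trivial on
  \<open>(2 ^ n - 1) R_S\<close>. As \<open>u\<close> is a unit of \<open>R_S\<close>, this ideal
  equals \<open>b R_S\<close>.\<close>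

lemma periodic_points_T_map_iff:
  assumes bu: "2 ^ n - 1 = b * u" and u: "S_number S u" and phi: "\<phi> \<in> characters (R_ring S)"
  shows "(T_map S ^^ n) \<phi> = \<phi> \<longleftrightarrow> (\<forall>r\<in>R_ring S. \<phi> (of_nat b * r) = 1)"
proof -
  have pow: "(2 ^ n :: rat) = of_nat b * of_nat u + 1"
  proof -
    have "2 ^ n = b * u + 1" using bu by (metis le_add_diff_inverse2 one_le_numeral one_le_power)
    then have "of_nat (2 ^ n) = (of_nat (b * u + 1) :: rat)" by (rule arg_cong)
    then show ?thesis by simp
  qed
  have R: "of_nat b * r \<in> R_ring S" if "r \<in> R_ring S" for r using that by (intro R_ring_mult) auto
  show ?thesis
  proof
    assume fixed: "(T_map S ^^ n) \<phi> = \<phi>"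
    show "\<forall>r\<in>R_ring S. \<phi> (of_nat b * r) = 1"
    proof
      fix r assume r: "r \<in> R_ring S"
      define s where "s = r * (1 / of_nat u)"
      have s: "s \<in> R_ring S" unfolding s_def by (intro R_ring_mult r R_ring_inverse_S_number u)
      have "2 ^ n * s = of_nat b * r + s"
        using S_number_pos[OF u] unfolding pow s_def by (simp add: field_simps)
      then have "\<phi> s = \<phi> (of_nat b * r) * \<phi> s"
        using T_map_funpow_apply[OF s, of n \<phi>] fixed characters_add[OF phi R[OF r] s] by simp
      moreover have "\<phi> s \<noteq> 0" using characters_norm[OF phi s] by auto
      ultimately show "\<phi> (of_nat b * r) = 1" by simp
    qed
  next
    assume *: "\<forall>r\<in>R_ring S. \<phi> (of_nat b * r) = 1"
    show "(T_map S ^^ n) \<phi> = \<phi>"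
    proof (rule characters_eqI[OF T_map_funpow_characters[OF phi] phi])
      fix r assume r: "r \<in> R_ring S"
      have ur: "of_nat u * r \<in> R_ring S" using r by (intro R_ring_mult) auto
      have "2 ^ n * r = of_nat b * (of_nat u * r) + r" unfolding pow by (simp add: algebra_simps)
      then have "\<phi> (2 ^ n * r) = \<phi> (of_nat b * (of_nat u * r)) * \<phi> r"
        using characters_add[OF phi R[OF ur] r] by simp
      then show "(T_map S ^^ n) \<phi> r = \<phi> r" using * ur by (simp add: T_map_funpow_apply[OF r])
    qed
  qed
qed

text \<open>Characters trivial on \<open>b R_S\<close> are characters of the cyclic group
  \<open>R_S / b R_S\<close> of order \<open>b\<close>; the class of \<open>1\<close> generates it,
  so the value there determines the character and may be any \<open>b\<close>-th root of
  unity.\<close>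

lemma bij_betw_annihilator_roots_of_unity:
  assumes b: "b > 0" "\<And>p. p \<in> S \<Longrightarrow> \<not> p dvd b"
  shows "bij_betw (\<lambda>\<phi>. \<phi> 1) {\<phi> \<in> characters (R_ring S). \<forall>r\<in>R_ring S. \<phi> (of_nat b * r) = 1}
           {z. z ^ b = 1}"
proof -
  let ?A = "{\<phi> \<in> characters (R_ring S). \<forall>r\<in>R_ring S. \<phi> (of_nat b * r) = 1}"
  have b0: "(of_nat b :: rat) \<noteq> 0" using b(1) by simp
  obtain res :: "rat \<Rightarrow> nat" where res: "\<And>r. r \<in> R_ring S \<Longrightarrow> (r - of_nat (res r)) / of_nat b \<in> R_ring S"
    using R_ring_residue[OF b] by metis
  have eq_pow: "\<phi> r = \<phi> 1 ^ res r" if "\<phi> \<in> ?A" and r: "r \<in> R_ring S" for \<phi> r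
  proof -
    have phi: "\<phi> \<in> characters (R_ring S)" and ann: "\<And>s. s \<in> R_ring S \<Longrightarrow> \<phi> (of_nat b * s) = 1"
      using that(1) by auto
    have "\<phi> (r - of_nat (res r)) = 1" using ann[OF res[OF r]] b0 by simp
    moreover have "\<phi> r = \<phi> (of_nat (res r)) * \<phi> (r - of_nat (res r))"
      using characters_add[OF phi, of "of_nat (res r)" "r - of_nat (res r)"] r
      by (simp add: R_ring_diff)
    ultimately show ?thesis using characters_of_nat_mult[OF phi, of 1 "res r"] by simp
  qed
  have dvdI: "int b dvd x" if "of_int x / of_nat b \<in> R_ring S" for x
    using dvd_of_div_in_R_ring[OF b that] .
  show ?thesis
    unfolding bij_betw_def
  proof
    show "inj_on (\<lambda>\<phi>. \<phi> 1) ?A"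
    proof (rule inj_onI)
      fix \<phi> \<psi> assume *: "\<phi> \<in> ?A" "\<psi> \<in> ?A" "\<phi> 1 = \<psi> 1"
      show "\<phi> = \<psi>"
      proof (rule characters_eqI)
        show "\<phi> r = \<psi> r" if "r \<in> R_ring S" for r
          using eq_pow[OF *(1) that] eq_pow[OF *(2) that] *(3) by simp
      qed (use * in auto)
    qed
    show "(\<lambda>\<phi>. \<phi> 1) ` ?A = {z. z ^ b = 1}"
    proof (intro equalityI subsetI)
      fix z assume "z \<in> (\<lambda>\<phi>. \<phi> 1) ` ?A"
      then obtain \<phi> where z: "z = \<phi> 1" and phi: "\<phi> \<in> characters (R_ring S)"
        and ann: "\<forall>r\<in>R_ring S. \<phi> (of_nat b * r) = 1" by auto
      have "z ^ b = \<phi> (of_nat b * 1)" unfolding z by (rule characters_of_nat_mult[OF phi, symmetric]) simp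
      then show "z \<in> {z. z ^ b = 1}" using bspec[OF ann R_ring_numerals(2)] by simp
    next
      fix z :: complex assume "z \<in> {z. z ^ b = 1}"
      then have z: "z ^ b = 1" by simp
      then have "norm z ^ b = 1" by (metis norm_one norm_power)
      then have norm: "norm z = 1" using b(1) power_eq_imp_eq_base[of "norm z" b 1] by simp
      \<comment> \<open>The chosen residues \<open>res r\<close> are additive only modulo
        \<open>b\<close>, which suffices because \<open>z ^ b = 1\<close>.\<close>
      define \<phi> where "\<phi> = (\<lambda>r\<in>R_ring S. z ^ res r)"
      have add: "\<phi> (r + s) = \<phi> r * \<phi> s" if r: "r \<in> R_ring S" and s: "s \<in> R_ring S" for r s
      proof -
        have "(r - of_nat (res r)) / of_nat b + (s - of_nat (res s)) / of_nat b
              - (r + s - of_nat (res (r + s))) / of_nat b \<in> R_ring S"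
          by (intro R_ring_diff R_ring_add res r s)
        moreover have "(r - of_nat (res r)) / of_nat b + (s - of_nat (res s)) / of_nat b
              - (r + s - of_nat (res (r + s))) / of_nat b
           = of_int (int (res (r + s)) - int (res r + res s)) / of_nat b"
          using b0 by (simp add: field_simps)
        ultimately have "z ^ res (r + s) = z ^ (res r + res s)"
          by (intro root_of_unity_power_cong[OF z] dvdI) simp
        then show ?thesis using r s by (simp add: \<phi>_def R_ring_add power_add)
      qed
      have phi: "\<phi> \<in> characters (R_ring S)"
        using add norm unfolding characters_def by (auto simp: \<phi>_def norm_power)
      have one: "\<phi> 1 = z"
      proof -
        have "(1 - of_nat (res 1)) / of_nat b = (of_int (int 1 - int (res 1)) :: rat) / of_nat b" by simp
        then have "int b dvd int 1 - int (res 1)"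
          using res[of 1] by (intro dvdI) (simp only: R_ring_numerals)
        then have "z ^ 1 = z ^ res 1" by (intro root_of_unity_power_cong[OF z])
        then show ?thesis by (simp add: \<phi>_def)
      qed
      have "\<phi> (of_nat b * r) = 1" if "r \<in> R_ring S" for r
        using characters_of_nat_mult[OF phi that, of b] that z
        by (simp add: \<phi>_def power_mult[symmetric] mult.commute[of _ b]) (simp add: power_mult)
      then show "z \<in> (\<lambda>\<phi>. \<phi> 1) ` ?A" using phi one by (intro image_eqI[of _ _ \<phi>]) auto
    qed
  qed
qed

text \<open>This is \<open>|2 ^ n - 1|_S\<close> for \<open>n \<ge> 1\<close>. At
  \<open>n = 0\<close> the value is 1, because \<open>multiplicity p 0 = 0\<close>; the sums below
  start at \<open>n = 1\<close>.\<close>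

definition S_abs :: "nat set \<Rightarrow> nat \<Rightarrow> real" where
  "S_abs S n = (\<Prod>p\<in>S. 1 / real p ^ multiplicity p (2 ^ n - 1 :: nat))"

lemma S_abs_nonneg: "S_abs S n \<ge> 0"
  unfolding S_abs_def by (intro prod_nonneg) auto

lemma S_abs_le_1:
  assumes "\<And>p. p \<in> S \<Longrightarrow> prime p"
  shows "S_abs S n \<le> 1"
  unfolding S_abs_def using assms
  by (intro prod_le_1) (auto simp: divide_le_eq prime_ge_1_nat intro!: one_le_power)

lemma periodic_points_T_map:
  assumes S: "finite S" "\<And>p. p \<in> S \<Longrightarrow> prime p" and n: "n > 0"
  shows "finite (periodic_points (characters (R_ring S)) (T_map S) n)"
    and "real (card (periodic_points (characters (R_ring S)) (T_map S) n)) = (2 ^ n - 1) * S_abs S n"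
proof -
  have m: "(2::nat) ^ n - 1 > 0" using n one_less_power[of "2::nat" n] by simp
  obtain b where b: "2 ^ n - 1 = b * S_part S (2 ^ n - 1)" "\<forall>p\<in>S. \<not> p dvd b"
    using S_part_decomposition[OF S m] by blast
  have b0: "b > 0" using b(1) m by (metis gr0I mult_is_0)
  have "periodic_points (characters (R_ring S)) (T_map S) n
     = {\<phi> \<in> characters (R_ring S). \<forall>r\<in>R_ring S. \<phi> (of_nat b * r) = 1}"
    using periodic_points_T_map_iff[OF b(1) S_number_S_part[OF S]] unfolding periodic_points_def by blast
  then have bij: "bij_betw (\<lambda>\<phi>. \<phi> 1) (periodic_points (characters (R_ring S)) (T_map S) n) {z. z ^ b = 1}"
    using bij_betw_annihilator_roots_of_unity[OF b0, of S] b(2) by simp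
  show "finite (periodic_points (characters (R_ring S)) (T_map S) n)"
    using bij_betw_finite[OF bij] finite_roots_unity[of b] b0 by simp
  have "card (periodic_points (characters (R_ring S)) (T_map S) n) = b"
    using bij_betw_same_card[OF bij] card_roots_unity_eq[OF b0] by simp
  moreover have "real b = (2 ^ n - 1) * S_abs S n"
  proof -
    have u0: "S_part S (2 ^ n - 1) \<noteq> 0" using b(1) m by (metis mult_0_right less_irrefl)
    have "S_abs S n = 1 / real (S_part S (2 ^ n - 1))"
      by (simp add: S_abs_def S_part_def prod_dividef)
    moreover have "(2 ^ n - 1 :: real) = real b * real (S_part S (2 ^ n - 1))"
      using arg_cong[OF b(1), of real] by (simp add: of_nat_diff)
    ultimately show ?thesis using u0 by simp
  qed
  ultimately show "real (card (periodic_points (characters (R_ring S)) (T_map S) n)) = (2 ^ n - 1) * S_abs S n"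
    by simp
qed

subsection \<open>Closed orbits\<close>

text \<open>The index set \<open>{0..n}\<close> lists the starting point twice. The range form makes
  the orbit independent of its starting point; the form over \<open>{..<n}\<close> turns the
  cardinality condition into injectivity.\<close>

lemma periodic_orbit_eq_range:
  assumes "(T ^^ n) x = x" "n > 0"
  shows "(\<lambda>i. (T ^^ i) x) ` {0..n} = range (\<lambda>i. (T ^^ i) x)"
    and "(\<lambda>i. (T ^^ i) x) ` {0..n} = (\<lambda>i. (T ^^ i) x) ` {..<n}"
proof -
  have *: "(T ^^ i) x \<in> (\<lambda>i. (T ^^ i) x) ` {..<n}" for i
    using funpow_mod_eq[OF assms(1), of i] assms(2) by (intro image_eqI[of _ _ "i mod n"]) auto
  then show "(\<lambda>i. (T ^^ i) x) ` {0..n} = range (\<lambda>i. (T ^^ i) x)"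
    by fastforce
  from * show "(\<lambda>i. (T ^^ i) x) ` {0..n} = (\<lambda>i. (T ^^ i) x) ` {..<n}"
    by fastforce
qed

lemma range_funpow_eq_of_mem:
  assumes x: "(T ^^ n) x = x" "n > 0" and y: "y \<in> range (\<lambda>i. (T ^^ i) x)"
  shows "range (\<lambda>i. (T ^^ i) y) = range (\<lambda>i. (T ^^ i) x)"
proof -
  obtain i where i: "y = (T ^^ i) x" using y by blast
  \<comment> \<open>\<open>n * i\<close> is a multiple of the period and at least \<open>i\<close>,
    so \<open>n * i - i\<close> further steps lead from \<open>y\<close> back to
    \<open>x\<close>.\<close>
  have "(T ^^ (n * i)) x = x" using funpow_mod_eq[OF x(1), of "n * i"] by simp
  moreover have "n * i = (n * i - i) + i" using x(2) by simp
  ultimately have ret: "(T ^^ (n * i - i)) y = x" unfolding i by (metis funpow_add o_apply)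
  have 1: "(T ^^ k) y = (T ^^ (k + i)) x" for k by (simp add: i funpow_add)
  have 2: "(T ^^ k) x = (T ^^ (k + (n * i - i))) y" for k by (simp add: funpow_add ret)
  show ?thesis
  proof (intro equalityI image_subsetI)
    show "(T ^^ k) y \<in> range (\<lambda>i. (T ^^ i) x)" for k unfolding 1 by (rule rangeI)
    show "(T ^^ k) x \<in> range (\<lambda>i. (T ^^ i) y)" for k unfolding 2 by (rule rangeI)
  qed
qed

lemma funpow_commute_periodic: "(T ^^ n) x = x \<Longrightarrow> (T ^^ n) ((T ^^ i) x) = (T ^^ i) x"
  by (metis add.commute funpow_add o_apply)

definition least_periodic_points :: "'a set \<Rightarrow> ('a \<Rightarrow> 'a) \<Rightarrow> nat \<Rightarrow> 'a set" where
  "least_periodic_points X T n =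
     {x \<in> periodic_points X T n. card ((\<lambda>i. (T ^^ i) x) ` {0..n}) = n}"

lemma closed_orbits_altdef:
  "closed_orbits X T n = (\<lambda>x. (\<lambda>i. (T ^^ i) x) ` {0..n}) ` least_periodic_points X T n"
  by (auto simp: closed_orbits_def least_periodic_points_def periodic_points_def)

lemma closed_orbits_0 [simp]: "closed_orbits X T 0 = {}"
  by (auto simp: closed_orbits_def)

lemma card_of_closed_orbit: "\<tau> \<in> closed_orbits X T n \<Longrightarrow> card \<tau> = n"
  by (auto simp: closed_orbits_def)

text \<open>Orbits that share a point coincide, so the orbits of length \<open>n\<close> partition
  the points of least period \<open>n\<close> into blocks of size \<open>n\<close>.\<close>

lemma closed_orbits_card:
  assumes closed: "\<And>x. x \<in> X \<Longrightarrow> T x \<in> X" and fin: "finite (periodic_points X T n)" and n: "n > 0"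
  shows "finite (closed_orbits X T n)"
    and "n * card (closed_orbits X T n) = card (least_periodic_points X T n)"
proof -
  let ?P = "least_periodic_points X T n" and ?o = "\<lambda>x. (\<lambda>i. (T ^^ i) x) ` {0..n}"
  have funX: "(T ^^ i) x \<in> X" if "x \<in> X" for x i using that closed by (induction i) auto
  have per: "x \<in> X" "(T ^^ n) x = x" "card (?o x) = n" if "x \<in> ?P" for x
    using that by (auto simp: least_periodic_points_def periodic_points_def)
  have same: "y \<in> ?P \<and> ?o y = ?o x" if x: "x \<in> ?P" and y: "y \<in> ?o x" for x y
  proof -
    obtain i where i: "y = (T ^^ i) x" using y by blast
    have yn: "(T ^^ n) y = y" unfolding i by (rule funpow_commute_periodic[OF per(2)[OF x]])
    have "?o y = ?o x"
      using range_funpow_eq_of_mem[OF per(2)[OF x] n, of y] y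
      unfolding periodic_orbit_eq_range(1)[OF yn n] periodic_orbit_eq_range(1)[OF per(2)[OF x] n] by blast
    then show ?thesis
      using yn funX[OF per(1)[OF x], of i] per(3)[OF x] i
      by (auto simp: least_periodic_points_def periodic_points_def)
  qed
  have self: "x \<in> ?o x" for x by (rule image_eqI[of _ _ 0]) auto
  have finP: "finite ?P" using fin by (rule rev_finite_subset) (auto simp: least_periodic_points_def)
  then show finC: "finite (closed_orbits X T n)" unfolding closed_orbits_altdef by simp
  have Un: "\<Union>(closed_orbits X T n) = ?P"
    unfolding closed_orbits_altdef
  proof (intro equalityI subsetI)
    fix z
    show "z \<in> \<Union>(?o ` ?P)" if "z \<in> ?P" using that self by (rule UN_I)
    assume "z \<in> \<Union>(?o ` ?P)"
    then obtain x where "x \<in> ?P" "z \<in> ?o x" by (rule UN_E)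
    then show "z \<in> ?P" by (rule conjunct1[OF same])
  qed
  have "n * card (closed_orbits X T n) = card (\<Union>(closed_orbits X T n))"
  proof (rule card_partition[OF finC])
    show "finite (\<Union>(closed_orbits X T n))" unfolding Un by (rule finP)
    show "card c = n" if "c \<in> closed_orbits X T n" for c using that by (rule card_of_closed_orbit)
    fix c d assume c: "c \<in> closed_orbits X T n" and d: "d \<in> closed_orbits X T n" and neq: "c \<noteq> d"
    obtain x y where xy: "x \<in> ?P" "c = ?o x" "y \<in> ?P" "d = ?o y"
      using c d unfolding closed_orbits_altdef by (elim imageE) (rule that)
    show "c \<inter> d = {}"
    proof (rule ccontr)
      assume "c \<inter> d \<noteq> {}"
      then obtain z where "z \<in> ?o x" "z \<in> ?o y" using xy by blast
      then have "?o x = ?o y" using same[OF xy(1)] same[OF xy(3)] by metis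
      then show False using neq xy by simp
    qed
  qed
  then show "n * card (closed_orbits X T n) = card ?P" unfolding Un .
qed

text \<open>A repetition among the first \<open>n\<close> points gives a period
  \<open>d < n\<close>. Then \<open>n - d\<close> is a period too, and one of the two is at most
  \<open>n / 2\<close>. This takes the place of Moebius inversion over the divisors of
  \<open>n\<close>.\<close>

lemma period_le_half:
  assumes x: "(T ^^ n) x = x" "n > 0" and card: "card ((\<lambda>i. (T ^^ i) x) ` {0..n}) \<noteq> n"
  shows "\<exists>d\<in>{1..n div 2}. (T ^^ d) x = x"
proof -
  have "\<not> inj_on (\<lambda>i. (T ^^ i) x) {..<n}"
    using card unfolding periodic_orbit_eq_range(2)[OF x] by (metis card_image card_lessThan)
  then obtain i j where ij: "i < j" "j < n" "(T ^^ i) x = (T ^^ j) x"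
    by (auto simp: inj_on_def) (metis linorder_neqE_nat)
  define d where "d = j - i"
  have "(T ^^ (n - i)) ((T ^^ i) x) = x"
    using x(1) ij by (metis funpow_add o_apply le_add_diff_inverse2 less_imp_le less_trans)
  moreover have "(T ^^ (n - i)) ((T ^^ j) x) = (T ^^ d) x"
  proof -
    have "(T ^^ (n - i)) ((T ^^ j) x) = (T ^^ (d + n)) x"
      using ij by (simp add: funpow_add[symmetric, unfolded o_def, THEN fun_cong] d_def add.commute)
    then show ?thesis using x(1) by (simp add: funpow_add)
  qed
  ultimately have d: "(T ^^ d) x = x" using ij(3) by simp
  have dn: "1 \<le> d" "d < n" using ij by (auto simp: d_def)
  have "(T ^^ (n - d)) x = x"
    using x(1) d dn by (metis funpow_add o_apply le_add_diff_inverse2 less_imp_le)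
  moreover have "d \<in> {1..n div 2} \<or> n - d \<in> {1..n div 2}" using dn by auto
  ultimately show ?thesis using d by blast
qed

lemma card_least_periodic_points:
  assumes fin: "\<And>d. d \<ge> 1 \<Longrightarrow> finite (periodic_points X T d)" and n: "n > 0"
  shows "card (least_periodic_points X T n) \<le> card (periodic_points X T n)"
    and "card (periodic_points X T n)
       \<le> card (least_periodic_points X T n) + (\<Sum>d=1..n div 2. card (periodic_points X T d))"
proof -
  show "card (least_periodic_points X T n) \<le> card (periodic_points X T n)"
    using fin[of n] n by (intro card_mono) (auto simp: least_periodic_points_def)
  have "periodic_points X T n \<subseteq> least_periodic_points X T n \<union> (\<Union>d\<in>{1..n div 2}. periodic_points X T d)"
    using period_le_half[OF _ n] by (fastforce simp: least_periodic_points_def periodic_points_def)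
  then have "card (periodic_points X T n)
      \<le> card (least_periodic_points X T n \<union> (\<Union>d\<in>{1..n div 2}. periodic_points X T d))"
    using fin n by (intro card_mono) (auto simp: least_periodic_points_def)
  also have "\<dots> \<le> card (least_periodic_points X T n) + card (\<Union>d\<in>{1..n div 2}. periodic_points X T d)"
    by (rule card_Un_le)
  also have "card (\<Union>d\<in>{1..n div 2}. periodic_points X T d) \<le> (\<Sum>d=1..n div 2. card (periodic_points X T d))"
    by (rule card_UN_le) simp
  finally show "card (periodic_points X T n)
       \<le> card (least_periodic_points X T n) + (\<Sum>d=1..n div 2. card (periodic_points X T d))" by simp
qed

lemma M_sum_eq:
  assumes S: "finite S" "\<And>p. p \<in> S \<Longrightarrow> prime p"
  shows "M_sum S N = (\<Sum>n=1..N. real (card (closed_orbits (characters (R_ring S)) (T_map S) n)) / 2 ^ n)"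
proof -
  let ?X = "characters (R_ring S)" and ?T = "T_map S"
  let ?O = "closed_orbits ?X ?T"
  have fin: "finite (?O n)" for n
    using closed_orbits_card(1)[OF T_map_characters periodic_points_T_map(1)[OF S]]
    by (cases "n = 0") auto
  have disj: "?O i \<inter> ?O j = {}" if "i \<noteq> j" for i j
    using that card_of_closed_orbit by (metis disjoint_iff)
  have exp: "exp (- ln 2 * real n) = 1 / 2 ^ n" for n
    using exp_of_nat_mult[of n "ln 2 :: real"] by (simp add: exp_minus divide_inverse mult.commute)
  have "M_sum S N = (\<Sum>\<tau>\<in>(\<Union>n\<in>{..N}. ?O n). exp (- ln 2 * real (card \<tau>)))"
    by (simp add: M_sum_def topological_entropy_T_map topspace_dual_topology)
  also have "\<dots> = (\<Sum>n\<le>N. \<Sum>\<tau>\<in>?O n. exp (- ln 2 * real (card \<tau>)))"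
    using fin disj by (intro sum.UNION_disjoint) simp_all
  also have "\<dots> = (\<Sum>n\<le>N. real (card (?O n)) / 2 ^ n)"
  proof (rule sum.cong[OF refl])
    fix n
    have "(\<Sum>\<tau>\<in>?O n. exp (- ln 2 * real (card \<tau>))) = (\<Sum>\<tau>\<in>?O n. 1 / 2 ^ n)"
      by (intro sum.cong refl) (simp only: card_of_closed_orbit exp)
    then show "(\<Sum>\<tau>\<in>?O n. exp (- ln 2 * real (card \<tau>))) = real (card (?O n)) / 2 ^ n" by simp
  qed
  also have "\<dots> = (\<Sum>n=1..N. real (card (?O n)) / 2 ^ n)"
    by (rule sum.mono_neutral_right) (auto simp: not_less_eq_eq)
  finally show ?thesis .
qed

text \<open>A non-primitive period is at most \<open>n/2\<close>, so the points of smaller period contribute only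
  a geometrically decaying error.\<close>

lemma M_sum_main_term:
  assumes S: "finite S" "\<And>p. p \<in> S \<Longrightarrow> prime p"
  shows "\<exists>\<epsilon>. (\<forall>n. 0 \<le> \<epsilon> n \<and> \<epsilon> n \<le> 3 * (1 / sqrt 2) ^ n) \<and>
     (\<forall>N. M_sum S N = (\<Sum>n=1..N. S_abs S n / real n) - (\<Sum>n=1..N. \<epsilon> n))"
proof -
  let ?X = "characters (R_ring S)" and ?T = "T_map S"
  define F where "F n = card (periodic_points ?X ?T n)" for n
  define L where "L n = card (least_periodic_points ?X ?T n)" for n
  define \<epsilon> where "\<epsilon> n = (if n = 0 then 0 else (S_abs S n - real (L n) / 2 ^ n) / real n)" for n
  have fin: "finite (periodic_points ?X ?T d)" if "d \<ge> 1" for d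
    using periodic_points_T_map(1)[OF S] that by simp
  have F: "real (F n) = (2 ^ n - 1) * S_abs S n" if "n > 0" for n
    unfolding F_def by (rule periodic_points_T_map(2)[OF S that])
  have L: "L n \<le> F n" "F n \<le> L n + (\<Sum>d=1..n div 2. F d)" if "n > 0" for n
    using card_least_periodic_points[OF fin that] unfolding L_def F_def by auto
  have O: "real (card (closed_orbits ?X ?T n)) = real (L n) / real n" if "n > 0" for n
    using closed_orbits_card(2)[OF T_map_characters fin that] that
    by (simp add: L_def field_simps flip: of_nat_mult)
  have abs1: "S_abs S n \<le> 1" "S_abs S n \<ge> 0" for n using S_abs_le_1 S(2) S_abs_nonneg by blast+
  have geom: "(\<Sum>d=1..m. real (F d)) \<le> 2 * 2 ^ m" for m
  proof -
    have "(\<Sum>d=1..m. real (F d)) \<le> (\<Sum>d=1..m. 2 ^ d)"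
    proof (rule sum_mono)
      fix d assume "d \<in> {1..m}"
      then have "real (F d) = (2 ^ d - 1) * S_abs S d" by (intro F) simp
      also have "\<dots> \<le> (2 ^ d - 1) * 1" using abs1(1) by (intro mult_left_mono) auto
      also have "\<dots> \<le> 2 ^ d" by simp
      finally show "real (F d) \<le> 2 ^ d" .
    qed
    also have "\<dots> \<le> 2 * 2 ^ m" by (induction m) auto
    finally show ?thesis .
  qed
  have half: "(2::real) ^ (n div 2) / 2 ^ n \<le> (1 / sqrt 2) ^ n" for n
  proof -
    have "(2::real) ^ (n div 2) = sqrt 2 ^ (2 * (n div 2))" by (simp add: power_mult)
    also have "\<dots> \<le> sqrt 2 ^ n" by (rule power_increasing) auto
    finally have "(2::real) ^ (n div 2) / 2 ^ n \<le> sqrt 2 ^ n / 2 ^ n" by (simp add: divide_right_mono)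
    also have "\<dots> = (sqrt 2 / 2) ^ n" by (simp add: power_divide)
    also have "sqrt 2 / 2 = 1 / sqrt 2" by (simp add: field_simps)
    finally show ?thesis .
  qed
  have "0 \<le> \<epsilon> n \<and> \<epsilon> n \<le> 3 * (1 / sqrt 2) ^ n" for n
  proof (cases "n = 0")
    case False
    then have n: "n > 0" by simp
    \<comment> \<open>The term \<open>S_abs S n\<close> comes from the \<open>- 1\<close> in
      \<open>2 ^ n - 1\<close>. It is at most \<open>2 ^ (n div 2)\<close>, and the points of
      smaller period contribute at most twice that: hence the constant 3.\<close>
    have "S_abs S n - real (L n) / 2 ^ n = (real (F n) - real (L n) + S_abs S n) / 2 ^ n"
      unfolding F[OF n] by (simp add: field_simps)
    moreover have "real (F n) - real (L n) + S_abs S n \<ge> 0" using L(1)[OF n] abs1(2)[of n] by simp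
    moreover have "real (F n) - real (L n) + S_abs S n \<le> 3 * 2 ^ (n div 2)"
    proof -
      have "real (F n) \<le> real (L n + (\<Sum>d=1..n div 2. F d))" using L(2)[OF n] by (rule of_nat_mono)
      then have "real (F n) - real (L n) \<le> (\<Sum>d=1..n div 2. real (F d))" by simp
      also have "\<dots> \<le> 2 * 2 ^ (n div 2)" by (rule geom)
      finally have "real (F n) - real (L n) \<le> 2 * 2 ^ (n div 2)" .
      moreover have "S_abs S n \<le> 2 ^ (n div 2)" using abs1(1)[of n] by (rule order_trans) simp
      ultimately show ?thesis by linarith
    qed
    ultimately have *: "0 \<le> S_abs S n - real (L n) / 2 ^ n"
      "S_abs S n - real (L n) / 2 ^ n \<le> 3 * (2 ^ (n div 2) / 2 ^ n)"
      by (simp_all add: divide_right_mono)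
    have "(S_abs S n - real (L n) / 2 ^ n) / real n \<le> S_abs S n - real (L n) / 2 ^ n"
      using divide_left_mono[of 1 "real n" "S_abs S n - real (L n) / 2 ^ n"] * n by simp
    then show ?thesis using * half[of n] n by (auto simp: \<epsilon>_def)
  qed (simp add: \<epsilon>_def)
  moreover have "M_sum S N = (\<Sum>n=1..N. S_abs S n / real n) - (\<Sum>n=1..N. \<epsilon> n)" for N
  proof -
    have "M_sum S N = (\<Sum>n=1..N. S_abs S n / real n - \<epsilon> n)"
      using M_sum_eq[OF S] by (auto intro!: sum.cong simp: \<epsilon>_def O diff_divide_distrib mult.commute)
    then show ?thesis by (simp only: sum_subtractf)
  qed
  ultimately show ?thesis by blast
qed

subsection \<open>Mertens asymptotics\<close>

text \<open>A single \<open>B\<close> serves all \<open>d\<close>, so that estimates for different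
  \<open>d\<close> can be summed against an absolutely summable sequence.\<close>

definition uniform_mertens :: "(nat \<Rightarrow> real) \<Rightarrow> bool" where
  "uniform_mertens f \<longleftrightarrow> (\<exists>k C B. \<forall>d\<ge>1. \<bar>k d\<bar> \<le> B \<and> \<bar>C d\<bar> \<le> B \<and>
     (\<forall>N\<ge>1. \<bar>(\<Sum>n=1..N. if d dvd n then f n / real n else 0) - (k d * ln (real N) + C d)\<bar> \<le> B / real N))"

section \<open>Harmonic sums along multiples of \<open>d\<close>\<close>

lemma sum_multiples:
  fixes d N :: nat
  assumes "d \<ge> 1"
  shows "(\<Sum>n=1..N. if d dvd n then f n else (0::real)) = (\<Sum>m=1..N div d. f (d * m))"
proof -
  have "(\<Sum>n=1..N. if d dvd n then f n else 0) = (\<Sum>n\<in>{n\<in>{1..N}. d dvd n}. f n)"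
    by (rule sum.inter_filter[symmetric]) simp
  also have "{n\<in>{1..N}. d dvd n} = (*) d ` {1..N div d}"
  proof (intro equalityI subsetI)
    fix n assume "n \<in> {n\<in>{1..N}. d dvd n}"
    then obtain m where "n = d * m" "1 \<le> d * m" "d * m \<le> N" by auto
    then show "n \<in> (*) d ` {1..N div d}" using assms
      by (intro image_eqI[of _ _ m]) (auto simp: less_eq_div_iff_mult_less_eq mult.commute Suc_le_eq)
  next
    fix n assume "n \<in> (*) d ` {1..N div d}"
    then show "n \<in> {n\<in>{1..N}. d dvd n}" using assms
      by (auto simp: less_eq_div_iff_mult_less_eq mult.commute Suc_le_eq)
  qed
  also have "(\<Sum>n\<in>(*) d ` {1..N div d}. f n) = (\<Sum>m=1..N div d. f (d * m))"
    using assms by (subst sum.reindex) (auto simp: inj_on_def)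
  finally show ?thesis .
qed

text \<open>The error must be controlled for \<open>N < d\<close> as well. There the harmonic sum is
  empty, and \<open>- ln x \<le> 1 / x - 1\<close> together with \<open>euler_mascheroni < 1\<close>
  absorbs the remaining terms.\<close>

lemma harm_div_asymp:
  assumes "d \<ge> 1" "N \<ge> 1"
  shows "\<bar>harm (N div d) - ln (real N / real d) - euler_mascheroni\<bar> \<le> real d / real N"
proof -
  define x where "x = real N / real d"
  define M where "M = N div d"
  have x: "x > 0" using assms by (simp add: x_def)
  have inv: "real d / real N = 1 / x" by (simp add: x_def)
  have Mx: "real M \<le> x" "x < real M + 1"
  proof -
    have "M = nat \<lfloor>x\<rfloor>" unfolding M_def x_def by (simp add: floor_divide_of_nat_eq)
    then show "real M \<le> x" "x < real M + 1" using x by auto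
  qed
  have gamma: "euler_mascheroni > (0::real)" "euler_mascheroni < (1::real)"
    using euler_mascheroni_pos euler_mascheroni_less_13_over_22 by linarith+
  show ?thesis
  proof (cases "M = 0")
    case True
    then have "x < 1" using Mx by simp
    then have "ln x < 0" using x by simp
    moreover have "- ln x \<le> 1 / x - 1" using ln_le_minus_one[of "1 / x"] x by (simp add: ln_div)
    moreover have "1 / x > 0" using x by simp
    moreover have "1 / x \<ge> 1" using x \<open>x < 1\<close> by simp
    ultimately have "\<bar>- ln x - euler_mascheroni\<bar> \<le> 1 / x" using gamma by linarith
    then show ?thesis using True unfolding inv M_def[symmetric] x_def[symmetric] by (simp add: harm_def)
  next
    case False
    then obtain n where M: "M = Suc n" by (cases M) auto
    \<comment> \<open>With \<open>ln (M + 1)\<close> in place of \<open>ln x\<close> the error lies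
      in \<open>[- 1 / (2 * M), 0]\<close>; replacing it by \<open>ln x\<close> adds an amount in
      \<open>[0, 1 / x]\<close>. The signs are opposite, so the errors do not accumulate.\<close>
    have "harm M - ln (real M + 1) - euler_mascheroni \<le> 0"
      using euler_mascheroni_lower[of n] unfolding M by (simp add: algebra_simps) (smt (verit) divide_pos_pos of_nat_0_le_iff)
    moreover have "harm M - ln (real M + 1) - euler_mascheroni \<ge> - (1 / (2 * real M))"
      using euler_mascheroni_upper[of n] unfolding M by (simp add: algebra_simps)
    moreover have "0 \<le> ln (real M + 1) - ln x" using Mx x by simp
    moreover have "ln (real M + 1) - ln x \<le> 1 / x"
    proof -
      have "ln (real M + 1) - ln x = ln ((real M + 1) / x)" using x by (simp add: ln_div)
      also have "\<dots> \<le> (real M + 1) / x - 1" using x by (intro ln_le_minus_one) simp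
      also have "\<dots> \<le> 1 / x" using Mx x by (simp add: field_simps)
      finally show ?thesis .
    qed
    moreover have "1 / (2 * real M) \<le> 1 / x" using Mx x M by (intro divide_left_mono) auto
    ultimately have "\<bar>harm M - ln x - euler_mascheroni\<bar> \<le> 1 / x" by linarith
    then show ?thesis unfolding inv M_def[symmetric] x_def[symmetric] .
  qed
qed

lemma uniform_mertens_1: "uniform_mertens (\<lambda>_. 1)"
  unfolding uniform_mertens_def
proof (rule exI[of _ "\<lambda>d. 1 / real d"], rule exI[of _ "\<lambda>d. (euler_mascheroni - ln (real d)) / real d"],
       rule exI[of _ 2], intro allI impI conjI)
  fix d :: nat assume d: "d \<ge> 1"
  show "\<bar>1 / real d\<bar> \<le> 2" using d by (simp add: field_simps)
  have "\<bar>euler_mascheroni - ln (real d)\<bar> \<le> 1 + ln (real d)"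
  proof -
    have "ln (real d) \<ge> 0" using d by simp
    moreover have "euler_mascheroni < (1::real)" using euler_mascheroni_less_13_over_22 by linarith
    ultimately show ?thesis using euler_mascheroni_pos by linarith
  qed
  also have "\<dots> \<le> 2 * real d" using ln_le_minus_one[of "real d"] d by simp
  finally show "\<bar>(euler_mascheroni - ln (real d)) / real d\<bar> \<le> 2" using d by (simp add: field_simps)
  fix N :: nat assume N: "N \<ge> 1"
  have "(\<Sum>n=1..N. if d dvd n then 1 / real n else 0) = harm (N div d) / real d"
    unfolding sum_multiples[OF d] harm_def sum_divide_distrib by (simp add: field_simps)
  moreover have "1 / real d * ln (real N) + (euler_mascheroni - ln (real d)) / real d
     = (ln (real N / real d) + euler_mascheroni) / real d"
    using d N by (simp add: ln_div add_divide_distrib diff_divide_distrib)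
  ultimately have "\<bar>(\<Sum>n=1..N. if d dvd n then 1 / real n else 0) -
      (1 / real d * ln (real N) + (euler_mascheroni - ln (real d)) / real d)\<bar>
     = \<bar>harm (N div d) - ln (real N / real d) - euler_mascheroni\<bar> / real d"
    using d by (simp add: diff_divide_distrib[symmetric] abs_divide algebra_simps)
  also have "\<dots> \<le> (real d / real N) / real d"
    using harm_div_asymp[OF d N] by (intro divide_right_mono) auto
  also have "\<dots> \<le> 2 / real N" using d N by (simp add: field_simps)
  finally show "\<bar>(\<Sum>n=1..N. if d dvd n then 1 / real n else 0) -
      (1 / real d * ln (real N) + (euler_mascheroni - ln (real d)) / real d)\<bar> \<le> 2 / real N" .
qed

text \<open>Multiplying by \<open>\<Sum>\<^sub>j a\<^sub>j [L\<^sub>j | n]\<close> turns the condition \<open>d | n\<close> into \<open>lcm d L\<^sub>j | n\<close>; this is why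
  uniformity in \<open>d\<close> is carried along.\<close>

lemma uniform_mertens_mult:
  assumes f: "uniform_mertens f" and a: "summable (\<lambda>j. \<bar>a j\<bar>)" and L: "\<And>j. L j \<ge> 1"
    and g: "\<And>n. n \<ge> 1 \<Longrightarrow> (\<lambda>j. a j * (if L j dvd n then 1 else 0)) sums g n"
  shows "uniform_mertens (\<lambda>n. f n * g n)"
proof -
  obtain k C B where kCB: "\<forall>d\<ge>1. \<bar>k d\<bar> \<le> B \<and> \<bar>C d\<bar> \<le> B \<and>
     (\<forall>N\<ge>1. \<bar>(\<Sum>n=1..N. if d dvd n then f n / real n else 0) - (k d * ln (real N) + C d)\<bar> \<le> B / real N)"
    using f unfolding uniform_mertens_def by (elim exE) (rule that)
  then have B: "\<And>d. d \<ge> 1 \<Longrightarrow> \<bar>k d\<bar> \<le> B" "\<And>d. d \<ge> 1 \<Longrightarrow> \<bar>C d\<bar> \<le> B"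
    "\<And>d N. d \<ge> 1 \<Longrightarrow> N \<ge> 1 \<Longrightarrow> \<bar>(\<Sum>n=1..N. if d dvd n then f n / real n else 0)
        - (k d * ln (real N) + C d)\<bar> \<le> B / real N"
    by simp_all
  define A where "A = (\<Sum>j. \<bar>a j\<bar>)"
  have lcm: "lcm d (L j) \<ge> 1" if "d \<ge> 1" for d j
    using that L[of j] by (metis One_nat_def Suc_le_eq lcm_pos_nat)
  \<comment> \<open>This one estimate serves three times: for the new leading coefficient, for the
    new constant and for the error term.\<close>
  have bound: "summable (\<lambda>j. a j * h j) \<and> \<bar>\<Sum>j. a j * h j\<bar> \<le> A * D" if h: "\<And>j. \<bar>h j\<bar> \<le> D" for h D
  proof -
    have le: "norm (a j * h j) \<le> \<bar>a j\<bar> * D" for j using h[of j] by (simp add: abs_mult mult_left_mono)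
    have sm: "summable (\<lambda>j. \<bar>a j\<bar> * D)" using a by (rule summable_mult2)
    have "summable (\<lambda>j. a j * h j)" by (rule summable_comparison_test'[OF sm, of 0]) (rule le)
    moreover have "norm (\<Sum>j. a j * h j) \<le> (\<Sum>j. \<bar>a j\<bar> * D)" by (rule norm_suminf_le[OF le sm])
    moreover have "(\<Sum>j. \<bar>a j\<bar> * D) = A * D" unfolding A_def by (rule suminf_mult2[OF a, symmetric])
    ultimately show ?thesis by simp
  qed
  define K where "K d = (\<Sum>j. a j * k (lcm d (L j)))" for d
  define C' where "C' d = (\<Sum>j. a j * C (lcm d (L j)))" for d
  have main: "\<bar>(\<Sum>n=1..N. if d dvd n then f n * g n / real n else 0) - (K d * ln (real N) + C' d)\<bar>
      \<le> (A * B) / real N" if d: "d \<ge> 1" and N: "N \<ge> 1" for d N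
  proof -
    define s where "s j = (\<Sum>n=1..N. if lcm d (L j) dvd n then f n / real n else 0)" for j
    have "(\<lambda>j. a j * (if lcm d (L j) dvd n then f n / real n else 0))
        sums (if d dvd n then f n * g n / real n else 0)" if "n \<in> {1..N}" for n
    proof (cases "d dvd n")
      case True
      have "(\<lambda>j. (f n / real n) * (a j * (if L j dvd n then 1 else 0))) sums ((f n / real n) * g n)"
        using that by (intro sums_mult g) simp
      moreover have "(f n / real n) * (a j * (if L j dvd n then 1 else 0))
          = a j * (if lcm d (L j) dvd n then f n / real n else 0)" for j
        using True by simp
      ultimately show ?thesis using True by simp
    next
      case False
      then have "\<not> lcm d (L j) dvd n" for j by (meson dvd_lcm1 dvd_trans)
      then show ?thesis using False by simp
    qed
    then have "(\<lambda>j. \<Sum>n=1..N. a j * (if lcm d (L j) dvd n then f n / real n else 0))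
        sums (\<Sum>n=1..N. if d dvd n then f n * g n / real n else 0)" by (rule sums_sum)
    then have 1: "(\<lambda>j. a j * s j) sums (\<Sum>n=1..N. if d dvd n then f n * g n / real n else 0)"
      unfolding s_def sum_distrib_left .
    have "(\<lambda>j. a j * k (lcm d (L j))) sums K d" "(\<lambda>j. a j * C (lcm d (L j))) sums C' d"
      unfolding K_def C'_def
      by (rule summable_sums[OF conjunct1[OF bound]], rule B(1)[OF lcm[OF d]])
         (rule summable_sums[OF conjunct1[OF bound]], rule B(2)[OF lcm[OF d]])
    then have "(\<lambda>j. a j * k (lcm d (L j)) * ln (real N) + a j * C (lcm d (L j)))
        sums (K d * ln (real N) + C' d)"
      by (intro sums_add sums_mult2)
    with 1 have "(\<lambda>j. a j * s j - (a j * k (lcm d (L j)) * ln (real N) + a j * C (lcm d (L j))))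
        sums ((\<Sum>n=1..N. if d dvd n then f n * g n / real n else 0) - (K d * ln (real N) + C' d))"
      by (rule sums_diff)
    moreover have "a j * s j - (a j * k (lcm d (L j)) * ln (real N) + a j * C (lcm d (L j)))
        = a j * (s j - (k (lcm d (L j)) * ln (real N) + C (lcm d (L j))))" for j
      by (simp add: algebra_simps)
    ultimately have "(\<lambda>j. a j * (s j - (k (lcm d (L j)) * ln (real N) + C (lcm d (L j)))))
        sums ((\<Sum>n=1..N. if d dvd n then f n * g n / real n else 0) - (K d * ln (real N) + C' d))"
      by simp
    moreover have "\<bar>s j - (k (lcm d (L j)) * ln (real N) + C (lcm d (L j)))\<bar> \<le> B / real N" for j
      unfolding s_def using B(3)[OF lcm[OF d] N] .
    ultimately show ?thesis using bound[of "\<lambda>j. s j - (k (lcm d (L j)) * ln (real N) + C (lcm d (L j)))" "B / real N"]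
      by (simp add: sums_iff)
  qed
  have KC: "\<bar>K d\<bar> \<le> A * B" "\<bar>C' d\<bar> \<le> A * B" if d: "d \<ge> 1" for d
    unfolding K_def C'_def
    by (rule conjunct2[OF bound], rule B(1)[OF lcm[OF d]])
       (rule conjunct2[OF bound], rule B(2)[OF lcm[OF d]])
  show ?thesis
    unfolding uniform_mertens_def using main KC
    by (intro exI[of _ K] exI[of _ C'] exI[of _ "A * B"]) simp
qed

text \<open>\<open>p\<^sup>j\<close> divides \<open>2\<^sup>n - 1\<close> iff the order of 2 modulo \<open>p\<^sup>j\<close> divides \<open>n\<close>; telescoping over \<open>j\<close>
  expands \<open>|2\<^sup>n - 1|\<^sub>p\<close> into divisibility conditions on \<open>n\<close>.\<close>

lemma padic_factor_sums:
  assumes p: "prime p" "odd p" and n: "n \<ge> 1"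
  shows "(\<lambda>j. (if j = 0 then 1 else 1 / real p ^ j - 1 / real p ^ (j - 1)) *
            (if ord (p ^ j) 2 dvd n then 1 else 0)) sums (1 / real p ^ multiplicity p (2 ^ n - 1 :: nat))"
proof -
  let ?a = "\<lambda>j. if j = 0 then 1 else 1 / real p ^ j - 1 / real p ^ (j - 1)"
  define v where "v = multiplicity p (2 ^ n - 1 :: nat)"
  have pos: "(2::nat) ^ n - 1 \<noteq> 0" using n one_less_power[of "2::nat" n] by simp
  have iff: "ord (p ^ j) 2 dvd n \<longleftrightarrow> j \<le> v" for j
  proof -
    have "ord (p ^ j) 2 dvd n \<longleftrightarrow> [2 ^ n = 1] (mod p ^ j)" by (rule ord_divides[symmetric])
    also have "\<dots> \<longleftrightarrow> p ^ j dvd 2 ^ n - 1" by (subst cong_altdef_nat) auto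
    also have "\<dots> \<longleftrightarrow> j \<le> v" unfolding v_def
      using pos p(1) not_prime_unit by (intro power_dvd_iff_le_multiplicity) auto
    finally show ?thesis .
  qed
  have "(\<Sum>j\<le>v. ?a j) = 1 / real p ^ v" by (induction v) auto
  moreover have "(\<lambda>j. ?a j * (if j \<le> v then 1 else 0)) sums (\<Sum>j\<le>v. ?a j * (if j \<le> v then 1 else 0))"
    by (rule sums_finite) auto
  ultimately show ?thesis unfolding iff v_def[symmetric] by simp
qed

lemma uniform_mertens_S_abs:
  assumes "finite S" "\<And>p. p \<in> S \<Longrightarrow> prime p"
  shows "uniform_mertens (S_abs S)"
  using assms
proof (induction S rule: finite_induct)
  case empty
  have "S_abs {} = (\<lambda>_. 1)" by (simp add: S_abs_def fun_eq_iff)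
  then show ?case using uniform_mertens_1 by simp
next
  case (insert p S)
  then have IH: "uniform_mertens (S_abs S)" and p: "prime p" by auto
  let ?g = "\<lambda>n. 1 / real p ^ multiplicity p (2 ^ n - 1 :: nat)"
  have "uniform_mertens (\<lambda>n. S_abs S n * ?g n)"
  proof (cases "odd p")
    case True
    let ?a = "\<lambda>j. if j = 0 then 1 else 1 / real p ^ j - 1 / real p ^ (j - 1)"
    have p1: "real p > 1" using prime_gt_1_nat[OF p] by simp
    have "summable (\<lambda>j. \<bar>?a j\<bar>)"
    proof (rule summable_comparison_test')
      have "summable (\<lambda>j. (1 / real p) ^ j)" using p1 by (intro summable_geometric) simp
      then show "summable (\<lambda>j. (real p + 1) * (1 / real p) ^ j)" by (rule summable_mult)
      fix j :: nat
      show "norm \<bar>?a j\<bar> \<le> (real p + 1) * (1 / real p) ^ j"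
      proof (cases j)
        case (Suc i)
        have "\<bar>?a j\<bar> \<le> 1 / real p ^ Suc i + 1 / real p ^ i" using p1 Suc by (simp add: abs_le_iff)
        also have "\<dots> = (real p + 1) * (1 / real p) ^ j" using p1 Suc by (simp add: field_simps)
        finally show ?thesis by simp
      qed (use p1 in simp)
    qed
    moreover have "ord (p ^ j) 2 \<ge> 1" for j
    proof -
      have "coprime p 2" using True by simp
      then have "ord (p ^ j) 2 > 0" by simp
      then show ?thesis by linarith
    qed
    ultimately show ?thesis
      by (rule uniform_mertens_mult[OF IH]) (rule padic_factor_sums[OF p True])
  next
    case False
    \<comment> \<open>2 has no multiplicative order modulo 2, but \<open>2 ^ n - 1\<close> is odd,
      so the factor is 1 and the expansion consists of one term with \<open>L = 1\<close>.\<close>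
    then have p2: "p = 2" using p primes_dvd_imp_eq two_is_prime_nat by blast
    have "?g n = 1" if "n \<ge> 1" for n
    proof -
      have "\<not> p dvd 2 ^ n - 1" using that p2 by simp
      then show ?thesis by (simp add: not_dvd_imp_multiplicity_0)
    qed
    moreover have "(\<lambda>j::nat. (if j = 0 then 1 else 0) * (if 1 dvd n then 1 else 0)) sums (1::real)" for n :: nat
      using sums_single[of 0 "\<lambda>_. 1::real"] by simp
    moreover have "summable (\<lambda>j::nat. \<bar>if j = 0 then 1 else 0 :: real\<bar>)"
      by (rule summable_comparison_test'[OF sums_summable[OF sums_single[of 0 "\<lambda>_. 1::real"]], of 0]) simp
    ultimately show ?thesis by (intro uniform_mertens_mult[OF IH, where L = "\<lambda>_. 1"]) auto
  qed
  moreover have "(\<lambda>n. S_abs S n * ?g n) = S_abs (insert p S)"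
    using insert.hyps by (simp add: S_abs_def fun_eq_iff mult.commute)
  ultimately show ?case by simp
qed

text \<open>The case \<open>d = 1\<close> handles the main sum. The correction
  \<open>\<epsilon>\<close> only shifts the constant, provided its tail is \<open>O(1/N)\<close>;
  weighting by \<open>n\<close> shows this, since the tail beyond \<open>N\<close> is at most
  \<open>1/N\<close> times the sum of all \<open>n * \<epsilon> n\<close>.\<close>

lemma exists_mertens_asymp:
  assumes S: "finite S" "\<And>p. p \<in> S \<Longrightarrow> prime p"
  shows "\<exists>k C. mertens_asymp S k C"
proof -
  obtain k C B where "\<forall>d\<ge>1. \<bar>k d\<bar> \<le> B \<and> \<bar>C d\<bar> \<le> B \<and>
     (\<forall>N\<ge>1. \<bar>(\<Sum>n=1..N. if d dvd n then S_abs S n / real n else 0) - (k d * ln (real N) + C d)\<bar> \<le> B / real N)"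
    using uniform_mertens_S_abs[OF S] unfolding uniform_mertens_def by blast
  from spec[OF this, of 1] have B: "\<And>N. N \<ge> 1 \<Longrightarrow>
      \<bar>(\<Sum>n=1..N. S_abs S n / real n) - (k 1 * ln (real N) + C 1)\<bar> \<le> B / real N" by simp
  obtain \<epsilon> where eps: "\<And>n. 0 \<le> \<epsilon> n" "\<And>n. \<epsilon> n \<le> 3 * (1 / sqrt 2) ^ n"
    "\<And>N. M_sum S N = (\<Sum>n=1..N. S_abs S n / real n) - (\<Sum>n=1..N. \<epsilon> n)"
    using M_sum_main_term[OF S] by blast
  have "summable (\<lambda>n. real (Suc n) * (1 / sqrt 2) ^ n)"
    using geometric_deriv_sums[of "1 / sqrt 2"] by (simp add: sums_iff)
  then have geom: "summable (\<lambda>n. 3 * (real (Suc n) * (1 / sqrt 2) ^ n))" by (rule summable_mult)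
  have sumW: "summable (\<lambda>n. real n * \<epsilon> n)"
  proof (rule summable_comparison_test'[OF geom, of 0])
    fix n
    have "real n * \<epsilon> n \<le> real (Suc n) * (3 * (1 / sqrt 2) ^ n)" using eps by (intro mult_mono) auto
    then show "norm (real n * \<epsilon> n) \<le> 3 * (real (Suc n) * (1 / sqrt 2) ^ n)" using eps(1)[of n] by simp
  qed
  have sumE: "summable \<epsilon>"
  proof (rule summable_comparison_test'[OF sumW, of 1])
    fix n :: nat assume "n \<ge> 1"
    then have "1 * \<epsilon> n \<le> real n * \<epsilon> n" using eps(1)[of n] by (intro mult_right_mono) auto
    then show "norm (\<epsilon> n) \<le> real n * \<epsilon> n" using eps(1)[of n] by simp
  qed
  define W where "W = (\<Sum>n. real n * \<epsilon> n)"
  \<comment> \<open>The finite sums start at \<open>n = 1\<close>, so the term at 0 is taken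
    out.\<close>
  define E where "E = (\<Sum>n. \<epsilon> n) - \<epsilon> 0"
  have tail: "\<bar>E - (\<Sum>n=1..N. \<epsilon> n)\<bar> \<le> W / real N" if "N \<ge> 1" for N
  proof -
    have "(\<Sum>n<Suc N. \<epsilon> n) = \<epsilon> 0 + (\<Sum>n=1..N. \<epsilon> n)"
      unfolding lessThan_Suc_atMost atMost_atLeast0 by (simp add: sum.atLeast_Suc_atMost)
    then have eq: "E - (\<Sum>n=1..N. \<epsilon> n) = (\<Sum>n. \<epsilon> (n + Suc N))"
      using suminf_minus_initial_segment[OF sumE, of "Suc N"] by (simp add: E_def)
    have sE: "summable (\<lambda>n. \<epsilon> (n + Suc N))" using sumE by (rule summable_ignore_initial_segment)
    have sW: "summable (\<lambda>n. real (n + Suc N) * \<epsilon> (n + Suc N))"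
      using sumW by (rule summable_ignore_initial_segment)
    have "real N * (\<Sum>n. \<epsilon> (n + Suc N)) = (\<Sum>n. real N * \<epsilon> (n + Suc N))"
      by (rule suminf_mult[OF sE, symmetric])
    also have "\<dots> \<le> (\<Sum>n. real (n + Suc N) * \<epsilon> (n + Suc N))"
      using eps(1) by (intro suminf_le summable_mult sE sW mult_right_mono) auto
    also have "\<dots> \<le> W"
      using suminf_minus_initial_segment[OF sumW, of "Suc N"] sum_nonneg[of "{..<Suc N}" "\<lambda>n. real n * \<epsilon> n"] eps(1)
      unfolding W_def by simp
    finally have "(\<Sum>n. \<epsilon> (n + Suc N)) \<le> W / real N" using that by (simp add: field_simps)
    moreover have "(\<Sum>n. \<epsilon> (n + Suc N)) \<ge> 0" using eps(1) by (intro suminf_nonneg sE) auto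
    ultimately show ?thesis unfolding eq by simp
  qed
  have "mertens_asymp S (k 1) (C 1 - E)"
    unfolding mertens_asymp_def
  proof (rule bigoI[where c = "B + W"], rule eventually_sequentiallyI[of 1])
    fix N :: nat assume N: "1 \<le> N"
    have "\<bar>M_sum S N - (k 1 * ln (real N) + (C 1 - E))\<bar> \<le> B / real N + W / real N"
      using B[OF N] tail[OF N] unfolding eps(3) by linarith
    then show "norm (M_sum S N - (k 1 * ln (real N) + (C 1 - E))) \<le> (B + W) * norm (1 / real N)"
      by (simp add: add_divide_distrib)
  qed
  then show ?thesis by blast
qed

subsection \<open>Logarithmic means\<close>

text \<open>For an indicator function this is logarithmic density. Such means are unique and
  monotone in \<open>f\<close>, which is how leading constants are compared without evaluating
  them.\<close>

definition logmean :: "(nat \<Rightarrow> real) \<Rightarrow> real \<Rightarrow> bool" where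
  "logmean f k \<longleftrightarrow> (\<lambda>N. (\<Sum>n=1..N. f n / real n) / ln (real N)) \<longlonglongrightarrow> k"

lemma logmeanI:
  assumes "\<forall>\<^sub>F N in sequentially. \<bar>(\<Sum>n=1..N. f n / real n) - k * ln (real N)\<bar> \<le> D"
  shows "logmean f k"
proof -
  have "filterlim (\<lambda>N. ln (real N)) at_top sequentially"
    by (rule filterlim_compose[OF ln_at_top filterlim_real_sequentially])
  then have lim: "(\<lambda>N. D / ln (real N)) \<longlonglongrightarrow> 0"
    by (intro tendsto_divide_0[OF tendsto_const] filterlim_at_top_imp_at_infinity)
  have "\<forall>\<^sub>F N in sequentially. norm ((\<Sum>n=1..N. f n / real n) / ln (real N) - k) \<le> D / ln (real N)"
    using assms eventually_ge_at_top[of 2]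
  proof eventually_elim
    case (elim N)
    then have ln: "ln (real N) > 0" by simp
    then have "(\<Sum>n=1..N. f n / real n) / ln (real N) - k
        = ((\<Sum>n=1..N. f n / real n) - k * ln (real N)) / ln (real N)" by (simp add: field_simps)
    then show ?case using elim ln by (simp add: abs_divide divide_right_mono)
  qed
  then show ?thesis unfolding logmean_def
    by (rule LIM_zero_cancel[OF Lim_null_comparison[OF _ lim]])
qed

lemma logmean_unique: "logmean f k \<Longrightarrow> logmean f l \<Longrightarrow> k = l"
  unfolding logmean_def by (rule LIMSEQ_unique)

lemma logmean_mono:
  assumes "logmean f k" "logmean g l" "\<And>n. n \<ge> 1 \<Longrightarrow> f n \<le> g n"
  shows "k \<le> l"
proof (rule LIMSEQ_le[OF assms(1,2)[unfolded logmean_def]], intro exI allI impI)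
  fix N :: nat assume "N \<ge> 1"
  then show "(\<Sum>n=1..N. f n / real n) / ln (real N) \<le> (\<Sum>n=1..N. g n / real n) / ln (real N)"
    using assms(3) by (intro divide_right_mono sum_mono) auto
qed

lemma logmean_diff: "logmean f k \<Longrightarrow> logmean g l \<Longrightarrow> logmean (\<lambda>n. f n - g n) (k - l)"
  unfolding logmean_def by (drule (1) tendsto_diff) (simp add: diff_divide_distrib sum_subtractf)

lemma logmean_cmult: "logmean f k \<Longrightarrow> logmean (\<lambda>n. c * f n) (c * k)"
  unfolding logmean_def by (drule tendsto_mult_left[of _ _ _ c]) (simp add: sum_distrib_left)

lemma logmean_multiples:
  assumes d: "d \<ge> 1"
  shows "logmean (\<lambda>n. if d dvd n then 1 else 0) (1 / real d)"
proof (rule logmeanI, rule eventually_sequentiallyI[of 1])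
  fix N :: nat assume N: "1 \<le> N"
  have "(\<Sum>n=1..N. (if d dvd n then 1 else 0) / real n) = (\<Sum>n=1..N. if d dvd n then 1 / real n else 0)"
    by (intro sum.cong) auto
  also have "\<dots> = harm (N div d) / real d"
    unfolding sum_multiples[OF d] harm_def sum_divide_distrib by (simp add: field_simps)
  finally have eq: "(\<Sum>n=1..N. (if d dvd n then 1 else 0) / real n) - 1 / real d * ln (real N)
      = (harm (N div d) - ln (real N)) / real d" by (simp add: diff_divide_distrib)
  have "real d / real N \<le> real d" using N d by (simp add: field_simps)
  moreover have "ln (real N / real d) = ln (real N) - ln (real d)" using N d by (simp add: ln_div)
  moreover have "0 < (euler_mascheroni :: real)" "euler_mascheroni < (1::real)"
    using euler_mascheroni_pos euler_mascheroni_less_13_over_22 by linarith+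
  ultimately have "\<bar>harm (N div d) - ln (real N)\<bar> \<le> real d + 1 + \<bar>ln (real d)\<bar>"
    using harm_div_asymp[OF d N] by linarith
  then show "\<bar>(\<Sum>n=1..N. (if d dvd n then 1 else 0) / real n) - 1 / real d * ln (real N)\<bar>
      \<le> (real d + 1 + \<bar>ln (real d)\<bar>) / real d"
    unfolding eq using d by (simp add: abs_divide divide_right_mono)
qed

lemma logmean_one: "logmean (\<lambda>_. 1) 1"
  using logmean_multiples[of 1] by simp

text \<open>\<open>M_sum\<close> differs from the main sum by at most
  \<open>suminf \<epsilon>\<close>. This and the constant \<open>C\<close> are bounded, hence vanish
  after division by \<open>ln N\<close>.\<close>

lemma logmean_S_abs:
  assumes S: "finite S" "\<And>p. p \<in> S \<Longrightarrow> prime p" and k: "mertens_asymp S k C"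
  shows "logmean (S_abs S) k"
proof -
  obtain \<epsilon> where eps: "\<And>n. 0 \<le> \<epsilon> n" "\<And>n. \<epsilon> n \<le> 3 * (1 / sqrt 2) ^ n"
    "\<And>N. M_sum S N = (\<Sum>n=1..N. S_abs S n / real n) - (\<Sum>n=1..N. \<epsilon> n)"
    using M_sum_main_term[OF S] by blast
  have sm: "summable (\<lambda>n. 3 * (1 / sqrt 2) ^ n)" by (intro summable_mult summable_geometric) simp
  have sE: "summable \<epsilon>" by (rule summable_comparison_test'[OF sm, of 0]) (use eps in simp)
  have E: "0 \<le> (\<Sum>n=1..N. \<epsilon> n) \<and> (\<Sum>n=1..N. \<epsilon> n) \<le> suminf \<epsilon>" for N
    using eps(1) by (auto intro!: sum_nonneg sum_le_suminf sE)
  obtain c where c: "c > 0"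
    "\<forall>\<^sub>F N in sequentially. norm (M_sum S N - (k * ln (real N) + C)) \<le> c * norm (1 / real N)"
    using k unfolding mertens_asymp_def by (elim landau_o.bigE)
  from c(2) eventually_ge_at_top[of 1]
  have "\<forall>\<^sub>F N in sequentially. \<bar>(\<Sum>n=1..N. S_abs S n / real n) - k * ln (real N)\<bar> \<le> c + \<bar>C\<bar> + suminf \<epsilon>"
  proof eventually_elim
    case (elim N)
    have "c * norm (1 / real N) \<le> c" using c(1) elim(2) by (simp add: field_simps)
    with elim(1) E[of N] show ?case unfolding eps(3) by (simp add: real_norm_def) linarith
  qed
  then show ?thesis by (rule logmeanI)
qed

lemma leading_constants_subset: "leading_constants \<subseteq> {0..1}"
proof
  fix k assume "k \<in> leading_constants"
  then obtain S C where S: "finite S" "\<And>p. p \<in> S \<Longrightarrow> prime p" "mertens_asymp S k C"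
    unfolding leading_constants_def by blast
  have k: "logmean (S_abs S) k" by (rule logmean_S_abs[OF S])
  have "0 \<le> k" using logmean_mono[OF logmean_cmult[OF logmean_one, of 0] k] S_abs_nonneg by simp
  moreover have "k \<le> 1" using logmean_mono[OF k logmean_one] S_abs_le_1[of S] S(2) by blast
  ultimately show "k \<in> {0..1}" by simp
qed

subsection \<open>Density of the leading constants\<close>

text \<open>Independence of divisibility by distinct primes. The extra condition
  \<open>d dvd n\<close> is what makes the induction close: expanding the factor of \<open>q\<close>
  produces the same expression for \<open>d * q\<close>, with weight \<open>- 1/2\<close>.\<close>

lemma logmean_sieve:
  assumes "finite P" "\<And>q. q \<in> P \<Longrightarrow> prime q" "d \<ge> 1" "\<And>q. q \<in> P \<Longrightarrow> coprime d q"
  shows "logmean (\<lambda>n. (if d dvd n then 1 else 0) * (\<Prod>q\<in>P. 1 - (if q dvd n then 1 / 2 else 0)))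
           (1 / real d * (\<Prod>q\<in>P. 1 - 1 / (2 * real q)))"
  using assms
proof (induction P arbitrary: d rule: finite_induct)
  case empty
  then show ?case using logmean_multiples by simp
next
  case (insert q P)
  let ?w = "\<lambda>n. \<Prod>q\<in>P. 1 - (if q dvd n then 1 / 2 else 0 :: real)"
  let ?W = "\<Prod>q\<in>P. 1 - 1 / (2 * real q)"
  have q: "prime q" "coprime d q" using insert.prems by auto
  have cop: "coprime (d * q) r" if "r \<in> P" for r
  proof -
    have "r \<noteq> q" using that insert.hyps by blast
    then have "coprime q r" using q(1) insert.prems(1)[of r] that by (simp add: primes_coprime)
    then show ?thesis using insert.prems(3)[of r] that by simp
  qed
  have "logmean (\<lambda>n. (if d dvd n then 1 else 0) * ?w n) (1 / real d * ?W)"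
    using insert.prems by (intro insert.IH) auto
  moreover have "logmean (\<lambda>n. (if d * q dvd n then 1 else 0) * ?w n) (1 / real (d * q) * ?W)"
    using insert.prems q(1) prime_gt_0_nat[OF q(1)] cop by (intro insert.IH) auto
  ultimately have "logmean (\<lambda>n. (if d dvd n then 1 else 0) * ?w n - 1 / 2 * ((if d * q dvd n then 1 else 0) * ?w n))
      (1 / real d * ?W - 1 / 2 * (1 / real (d * q) * ?W))"
    by (intro logmean_diff logmean_cmult)
  moreover have "(if d dvd n then 1 else 0) * ?w n - 1 / 2 * ((if d * q dvd n then 1 else 0) * ?w n)
      = (if d dvd n then 1 else 0) * (\<Prod>q\<in>insert q P. 1 - (if q dvd n then 1 / 2 else 0))" for n
  proof -
    have "d * q dvd n \<longleftrightarrow> d dvd n \<and> q dvd n"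
      using q(2) by (auto intro: divides_mult dvd_mult_left dvd_mult_right)
    then show ?thesis using insert.hyps by (auto simp: algebra_simps)
  qed
  moreover have "1 / real d * ?W - 1 / 2 * (1 / real (d * q) * ?W)
      = 1 / real d * (\<Prod>q\<in>insert q P. 1 - 1 / (2 * real q))"
    using insert.hyps insert.prems(2) prime_gt_0_nat[OF q(1)] by (simp add: field_simps)
  ultimately show ?case by simp
qed

text \<open>A truncated Euler product. An \<open>n\<close> counted for \<open>insert q P\<close> is
  either counted for \<open>P\<close> or is \<open>q\<close> times a smaller one of its own kind, so
  the sums satisfy \<open>B \<le> A + B / q\<close>.\<close>

lemma euler_product_bound:
  assumes "finite P" "\<And>q. q \<in> P \<Longrightarrow> prime q"
  shows "(\<Sum>n\<in>{n\<in>{1..X}. S_number P n}. 1 / real n) * (\<Prod>q\<in>P. 1 - 1 / real q) \<le> 1"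
  using assms
proof (induction P rule: finite_induct)
  case empty
  have "n = 1" if "S_number {} n" for n
    using that prime_factor_nat[of n] by (auto simp: S_number_def)
  then have "{n\<in>{1..X}. S_number {} n} \<subseteq> {1}" by auto
  then have "(\<Sum>n\<in>{n\<in>{1..X}. S_number {} n}. 1 / real n) \<le> (\<Sum>n\<in>{1}. 1 / real n)"
    by (intro sum_mono2) auto
  then show ?case by simp
next
  case (insert q P)
  let ?A = "{n\<in>{1..X}. S_number P n}" and ?B = "{n\<in>{1..X}. S_number (insert q P) n}"
  have q: "prime q" using insert.prems by simp
  have sub: "?B \<subseteq> ?A \<union> (*) q ` ?B"
  proof
    fix n assume n: "n \<in> ?B"
    show "n \<in> ?A \<union> (*) q ` ?B"
    proof (cases "q dvd n")
      case False
      then show ?thesis using n by (auto simp: S_number_def)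
    next
      case True
      then obtain m where m: "n = q * m" by (rule dvdE)
      have "S_number (insert q P) m" using n m S_number_dvd[of _ n m] by auto
      moreover have "m \<in> {1..X}"
      proof -
        have "m \<le> n" using m prime_gt_0_nat[OF q] by simp
        also have "n \<le> X" using n by simp
        finally show ?thesis using n m by (auto simp: Suc_le_eq intro!: gr0I)
      qed
      ultimately show ?thesis using m by blast
    qed
  qed
  have "(\<Sum>n\<in>?B. 1 / real n) \<le> (\<Sum>n\<in>?A \<union> (*) q ` ?B. 1 / real n)"
    by (rule sum_mono2[OF _ sub]) auto
  also have "\<dots> \<le> (\<Sum>n\<in>?A. 1 / real n) + (\<Sum>n\<in>(*) q ` ?B. 1 / real n)"
    by (subst sum_Un) (auto intro!: sum_nonneg)
  also have "(\<Sum>n\<in>(*) q ` ?B. 1 / real n) = (\<Sum>n\<in>?B. 1 / real q * (1 / real n))"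
    using prime_gt_0_nat[OF q] by (subst sum.reindex) (auto simp: inj_on_def)
  finally have "(\<Sum>n\<in>?B. 1 / real n) * (1 - 1 / real q) \<le> (\<Sum>n\<in>?A. 1 / real n)"
    by (simp only: sum_distrib_left[symmetric]) (simp add: algebra_simps)
  moreover have "(\<Prod>q\<in>P. 1 - 1 / real q) \<ge> 0"
    using insert.prems prime_ge_1_nat by (intro prod_nonneg) (auto simp: divide_le_eq)
  ultimately have "(\<Sum>n\<in>?B. 1 / real n) * (1 - 1 / real q) * (\<Prod>q\<in>P. 1 - 1 / real q)
      \<le> (\<Sum>n\<in>?A. 1 / real n) * (\<Prod>q\<in>P. 1 - 1 / real q)"
    by (rule mult_right_mono)
  also have "\<dots> \<le> 1" using insert by auto
  finally show ?case using insert.hyps by (simp add: mult.assoc)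
qed

text \<open>The square of \<open>1 - x / 2\<close> still exceeds \<open>1 - x\<close> by
  \<open>x * x / 4\<close>; squaring once more suffices. This transfers the divergence of the
  product of \<open>1 - 1/q\<close> to that of \<open>1 - 1/(2q)\<close>.\<close>

lemma half_factor_power4_le:
  assumes "0 \<le> x" "x \<le> (1/2::real)"
  shows "(1 - x / 2) ^ 4 \<le> 1 - x"
proof -
  have "x * x \<le> x * (1 / 2)" using assms by (intro mult_left_mono)
  then have "(1 - x / 2) ^ 2 \<le> 1 - 7 * x / 8" by (simp add: power2_eq_square field_simps)
  then have "((1 - x / 2) ^ 2) ^ 2 \<le> (1 - 7 * x / 8) ^ 2" by (rule power_mono) simp
  also have "\<dots> \<le> 1 - x" using \<open>x * x \<le> x * (1 / 2)\<close> by (simp add: power2_eq_square field_simps) (use assms in linarith)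
  finally show ?thesis by (simp flip: power_mult)
qed

text \<open>The primes below \<open>Q\<close> contribute a fixed positive factor \<open>c\<close>,
  so it is enough to push the product over all primes below \<open>Q + Suc X\<close> under
  \<open>c * e\<close>. Every \<open>n \<le> X\<close> has its prime factors among these, so the
  Euler product bound involves the whole harmonic sum up to \<open>X\<close>.\<close>

lemma sieve_product_small:
  assumes "e > 0"
  shows "\<exists>X. (\<Prod>q\<in>{q. prime q \<and> Q \<le> q \<and> q < Q + X}. 1 - 1 / (2 * real q)) < e"
proof -
  define G where "G A = (\<Prod>q\<in>A. 1 - 1 / (2 * real q))" for A :: "nat set"
  have fin: "finite {q::nat. prime q \<and> a \<le> q \<and> q < b}" for a b
    by (rule finite_subset[of _ "{..<b}"]) auto
  have pos: "0 < 1 - 1 / (2 * real q)" if "prime q" for q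
    using prime_ge_1_nat[OF that] by (simp add: field_simps)
  define c where "c = G {q. prime q \<and> q < Q}"
  have finQ: "finite {q::nat. prime q \<and> q < Q}" using fin[of 0 Q] by simp
  have c: "c > 0" unfolding c_def G_def using pos by (intro prod_pos) auto
  have "filterlim (harm :: nat \<Rightarrow> real) at_top sequentially" by (rule harm_at_top)
  \<comment> \<open>The threshold is the one at which \<open>G ?P ^ 4 \<le> 1 / harm X\<close> gives
    \<open>G ?P < c * e\<close>.\<close>
  then have "\<forall>\<^sub>F X in sequentially. 1 / (c * e) ^ 4 < (harm X :: real)"
    by (simp add: filterlim_at_top_dense)
  then obtain X where X: "1 / (c * e) ^ 4 < (harm X :: real)"
    unfolding eventually_sequentially by blast
  let ?P = "{q. prime q \<and> q < Q + Suc X}"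
  have finP: "finite ?P" using fin[of 0 "Q + Suc X"] by simp
  have split: "G ?P = c * G {q. prime q \<and> Q \<le> q \<and> q < Q + Suc X}"
    unfolding G_def c_def
    by (subst prod.union_disjoint[symmetric]) (auto intro!: prod.cong finQ fin)
  have "S_number ?P n" if "n \<in> {1..X}" for n
    using that by (auto simp: S_number_def dest: dvd_imp_le)
  then have all: "{n\<in>{1..X}. S_number ?P n} = {1..X}" by blast
  have "harm X * (\<Prod>q\<in>?P. 1 - 1 / real q) \<le> 1"
    using euler_product_bound[OF finP, of X] unfolding all harm_def by (simp add: divide_inverse)
  moreover have "G ?P ^ 4 \<le> (\<Prod>q\<in>?P. 1 - 1 / real q)"
    unfolding G_def prod_power_distrib
  proof (intro prod_mono conjI)
    fix q assume q: "q \<in> ?P"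
    then have "real q \<ge> 2" using prime_ge_2_nat by auto
    then show "(1 - 1 / (2 * real q)) ^ 4 \<le> 1 - 1 / real q"
      using half_factor_power4_le[of "1 / real q"] by (simp add: mult.commute)
  qed simp
  moreover have hX: "harm X > (0::real)"
    using X c assms by (meson less_trans zero_less_divide_1_iff zero_less_mult_iff zero_less_power)
  ultimately have "harm X * G ?P ^ 4 \<le> 1"
    by (meson mult_left_mono less_imp_le order_trans)
  then have "G ?P ^ 4 \<le> 1 / harm X" using hX by (simp add: field_simps)
  also have "\<dots> < (c * e) ^ 4" using X hX c assms by (simp add: field_simps)
  finally have "G ?P < c * e" by (rule power_less_imp_less_base) (use c assms in simp)
  then have "G {q. prime q \<and> Q \<le> q \<and> q < Q + Suc X} < e" unfolding split using c by simp
  then show ?thesis unfolding G_def by blast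
qed

text \<open>Since \<open>q\<close> is prime, 2 has order \<open>q\<close> modulo this prime.\<close>

definition mersenne_divisor :: "nat \<Rightarrow> nat" where
  "mersenne_divisor q = (SOME p. prime p \<and> p dvd 2 ^ q - 1)"

lemma mersenne_divisor:
  assumes "prime q"
  shows "prime (mersenne_divisor q)" "mersenne_divisor q dvd 2 ^ n - 1 \<longleftrightarrow> q dvd n"
proof -
  have "(2::nat) ^ 1 < 2 ^ q" using prime_gt_1_nat[OF assms] by (intro power_strict_increasing) auto
  then have "(2::nat) ^ q - 1 \<noteq> 1" by simp
  then have "\<exists>p. prime p \<and> p dvd (2::nat) ^ q - 1" by (rule prime_factor_nat)
  then have p: "prime (mersenne_divisor q)" "mersenne_divisor q dvd 2 ^ q - 1"
    unfolding mersenne_divisor_def by (metis (mono_tags, lifting) someI_ex)+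
  have iff: "mersenne_divisor q dvd 2 ^ n - 1 \<longleftrightarrow> ord (mersenne_divisor q) 2 dvd n" for n
  proof -
    have "mersenne_divisor q dvd 2 ^ n - 1 \<longleftrightarrow> [2 ^ n = 1] (mod mersenne_divisor q)"
      by (subst cong_altdef_nat) auto
    then show ?thesis by (simp only: ord_divides)
  qed
  \<comment> \<open>The order divides the prime \<open>q\<close>, so only the value 1 has to be
    excluded.\<close>
  have "ord (mersenne_divisor q) 2 \<noteq> 1"
  proof
    assume "ord (mersenne_divisor q) 2 = 1"
    then have "mersenne_divisor q dvd 2 ^ 1 - 1" unfolding iff by simp
    then show False using p(1) not_prime_1 by simp
  qed
  then have "ord (mersenne_divisor q) 2 = q"
    using p(2) assms unfolding iff prime_nat_iff by blast
  then show "prime (mersenne_divisor q)" "mersenne_divisor q dvd 2 ^ n - 1 \<longleftrightarrow> q dvd n"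
    using p(1) iff by simp_all
qed

text \<open>\<open>q\<close> is recovered as the order of 2 modulo the chosen prime.\<close>

lemma inj_on_mersenne_divisor: "inj_on mersenne_divisor {q. prime q}"
proof (rule inj_onI)
  fix q r assume "q \<in> {q. prime q}" "r \<in> {q. prime q}" "mersenne_divisor q = mersenne_divisor r"
  then have "q dvd r" "r dvd q"
    using mersenne_divisor(2) by (metis dvd_refl mem_Collect_eq)+
  then show "q = r" by (rule dvd_antisym)
qed

text \<open>If \<open>q\<close> divides \<open>n\<close>, the chosen prime occurs at least once in
  the nonzero number \<open>2 ^ n - 1\<close>, and being at least 2 it contributes a factor of at
  most \<open>1/2\<close>.\<close>

lemma mersenne_divisor_factor:
  assumes "prime q" "n \<ge> 1"
  shows "1 / real (mersenne_divisor q) ^ multiplicity (mersenne_divisor q) (2 ^ n - 1)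
           \<le> 1 - (if q dvd n then 1 / 2 else 0)"
proof (cases "q dvd n")
  case True
  let ?p = "mersenne_divisor q"
  have p: "prime ?p" "?p dvd 2 ^ n - 1" using mersenne_divisor[OF assms(1)] True by auto
  have "(2::nat) ^ n - 1 \<noteq> 0" using assms(2) one_less_power[of "2::nat" n] by simp
  then have "multiplicity ?p (2 ^ n - 1) \<ge> 1" using p by (intro multiplicity_geI) auto
  then have "real ?p ^ 1 \<le> real ?p ^ multiplicity ?p (2 ^ n - 1)"
    using prime_ge_1_nat[OF p(1)] by (intro power_increasing) auto
  moreover have "2 \<le> real ?p ^ 1" using prime_ge_2_nat[OF p(1)] by simp
  ultimately have "2 \<le> real ?p ^ multiplicity ?p (2 ^ n - 1)" by (rule order_trans[rotated])
  then have "1 / real ?p ^ multiplicity ?p (2 ^ n - 1) \<le> 1 / 2" by (intro frac_le) auto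
  then show ?thesis using True by simp
next
  case False
  then have "multiplicity (mersenne_divisor q) (2 ^ n - 1) = 0"
    using mersenne_divisor(2)[OF assms(1)] by (intro not_dvd_imp_multiplicity_0) simp
  then show ?thesis using False by simp
qed

lemma S_abs_mersenne_le:
  assumes "finite P" "\<And>q. q \<in> P \<Longrightarrow> prime q" "n \<ge> 1"
  shows "S_abs (mersenne_divisor ` P) n \<le> (\<Prod>q\<in>P. 1 - (if q dvd n then 1 / 2 else 0))"
proof -
  have "inj_on mersenne_divisor P"
    by (rule inj_on_subset[OF inj_on_mersenne_divisor]) (use assms in auto)
  then have "S_abs (mersenne_divisor ` P) n
      = (\<Prod>q\<in>P. 1 / real (mersenne_divisor q) ^ multiplicity (mersenne_divisor q) (2 ^ n - 1))"
    by (simp add: S_abs_def prod.reindex)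
  also have "\<dots> \<le> (\<Prod>q\<in>P. 1 - (if q dvd n then 1 / 2 else 0))"
    using assms by (intro prod_mono conjI mersenne_divisor_factor) auto
  finally show ?thesis .
qed

text \<open>Adjoining the prime alters the value only at multiples of \<open>q\<close>, and all
  values lie in \<open>[0, 1]\<close>. Passing to logarithmic means bounds the drop by
  \<open>1/q\<close>.\<close>

lemma S_abs_insert_mersenne:
  assumes "finite S" "\<And>p. p \<in> S \<Longrightarrow> prime p" "prime q" "n \<ge> 1"
  shows "S_abs S n - S_abs (insert (mersenne_divisor q) S) n \<le> (if q dvd n then 1 else 0)"
proof (cases "mersenne_divisor q \<in> S \<or> q dvd n")
  case True
  then show ?thesis
    using S_abs_nonneg[of "insert (mersenne_divisor q) S" n] S_abs_le_1[of S n] assms(2)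
    by (auto simp: insert_absorb)
next
  case False
  then have "multiplicity (mersenne_divisor q) (2 ^ n - 1) = 0"
    using mersenne_divisor(2)[OF assms(3)] by (intro not_dvd_imp_multiplicity_0) simp
  then have "S_abs (insert (mersenne_divisor q) S) n = S_abs S n"
    using assms(1) False by (simp add: S_abs_def)
  then show ?thesis using False by simp
qed

lemma leading_constants_dense: "{0..1} \<subseteq> closure leading_constants"
proof
  fix x :: real assume x: "x \<in> {0..1}"
  show "x \<in> closure leading_constants"
    unfolding closure_approachable
  proof (intro allI impI)
    fix e :: real assume e: "e > 0"
    obtain m where m: "inverse (real (Suc m)) < e" using reals_Archimedean[OF e] by blast
    define Q where "Q = Suc m"
    have Q: "Q > 0" "1 / real Q < e" using m by (simp_all add: Q_def inverse_eq_divide)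
    \<comment> \<open>The window grows by one integer at a time, so at most one prime is adjoined
      per step and nothing changes when \<open>Q + j\<close> is composite.\<close>
    define P where "P j = {q. prime q \<and> Q \<le> q \<and> q < Q + j}" for j
    have P: "finite (P j)" "\<And>q. q \<in> P j \<Longrightarrow> prime q" for j
      unfolding P_def by (auto intro: finite_subset[of _ "{..<Q + j}"])
    define S where "S j = mersenne_divisor ` P j" for j
    have S: "finite (S j)" "\<And>p. p \<in> S j \<Longrightarrow> prime p" for j
      unfolding S_def using P mersenne_divisor(1) by auto
    have "\<exists>k. k \<in> leading_constants \<and> logmean (S_abs (S j)) k" for j
    proof -
      obtain k C where k: "mertens_asymp (S j) k C" using exists_mertens_asymp[OF S(1)[of j] S(2)[of _ j]] by blast
      then have "k \<in> leading_constants" using S(1)[of j] S(2)[of _ j] unfolding leading_constants_def by blast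
      then show ?thesis using logmean_S_abs[OF S(1)[of j] S(2)[of _ j] k] by blast
    qed
    then obtain \<kappa> where kap: "\<And>j. \<kappa> j \<in> leading_constants" "\<And>j. logmean (S_abs (S j)) (\<kappa> j)"
      by metis
    have S0: "S 0 = {}" by (simp add: S_def P_def)
    have "S_abs {} = (\<lambda>_. 1)" by (simp add: S_abs_def fun_eq_iff)
    then have kap0: "\<kappa> 0 = 1" using logmean_unique[OF kap(2)[of 0]] logmean_one by (simp add: S0)
    have step: "\<kappa> j - \<kappa> (Suc j) \<le> 1 / real Q" for j
    proof (cases "prime (Q + j)")
      case True
      have "P (Suc j) = insert (Q + j) (P j)" using True by (auto simp: P_def)
      then have ins: "S (Suc j) = insert (mersenne_divisor (Q + j)) (S j)" by (simp add: S_def)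
      have "\<kappa> j - \<kappa> (Suc j) \<le> 1 / real (Q + j)"
        using S_abs_insert_mersenne[OF S(1)[of j] S(2)[of _ j] True] prime_ge_1_nat[OF True] ins
        by (intro logmean_mono[OF logmean_diff[OF kap(2) kap(2)] logmean_multiples]) auto
      also have "\<dots> \<le> 1 / real Q" using Q(1) by (intro divide_left_mono) auto
      finally show ?thesis .
    next
      case False
      then have "P (Suc j) = P j" by (auto simp: P_def less_Suc_eq)
      then have "\<kappa> (Suc j) = \<kappa> j"
        using logmean_unique[OF kap(2)[of "Suc j"]] kap(2)[of j] by (simp add: S_def)
      then show ?thesis using Q(1) by simp
    qed
    have "\<exists>j. \<kappa> j < x + e"
    proof -
      obtain X where X: "(\<Prod>q\<in>P X. 1 - 1 / (2 * real q)) < e"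
        using sieve_product_small[OF e] unfolding P_def by blast
      have "logmean (\<lambda>n. \<Prod>q\<in>P X. 1 - (if q dvd n then 1 / 2 else 0)) (\<Prod>q\<in>P X. 1 - 1 / (2 * real q))"
        using logmean_sieve[OF P(1)[of X] P(2)[of _ X], of 1] by simp
      then have "\<kappa> X \<le> (\<Prod>q\<in>P X. 1 - 1 / (2 * real q))"
        using S_abs_mersenne_le[OF P(1)[of X] P(2)[of _ X]] unfolding S_def[symmetric] by (intro logmean_mono[OF kap(2)])
      then show ?thesis using X x by (intro exI[of _ X]) auto
    qed
    \<comment> \<open>The first index below \<open>x + e\<close> is also above \<open>x - e\<close>:
      its predecessor is still at least \<open>x + e\<close> and one step is shorter than
      \<open>e\<close>, while at index 0 the value is \<open>1 \<ge> x\<close>.\<close>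
    then obtain j where j: "\<kappa> j < x + e" "\<And>i. i < j \<Longrightarrow> \<not> \<kappa> i < x + e"
      using exists_least_iff[of "\<lambda>j. \<kappa> j < x + e"] by blast
    have "x - e < \<kappa> j"
    proof (cases j)
      case 0
      then show ?thesis using kap0 x e by auto
    next
      case (Suc i)
      then have "\<kappa> i \<ge> x + e" using j(2)[of i] by simp
      then show ?thesis using step[of i] Suc Q(2) e by simp
    qed
    then have "dist (\<kappa> j) x < e" using j(1) by (simp add: dist_real_def abs_less_iff)
    then show "\<exists>y\<in>leading_constants. dist y x < e" using kap(1) by blast
  qed
qed

theorem theorem1:
  "(\<forall>S. finite S \<and> S \<subseteq> {p. prime p} \<longrightarrow> (\<exists>k C. mertens_asymp S k C))
   \<and> leading_constants \<subseteq> {0..1} \<and> {0..1} \<subseteq> closure leading_constants"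
  using exists_mertens_asymp leading_constants_subset leading_constants_dense by blast

end
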